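(* Let $M$ be an infinite-dimensional connected $C^\infty$-smooth Banach manifold modelled on a smooth Banach space $E$, and let $V_1, V_2, \ldots$ be smooth vector fields on $M$. Consider the affine control system $$\dot q=\sum_{i=1}^\infty u_i(t) V_i (q).$$ Suppose that $$\overline{\mathcal{L}[V_1,V_2,\ldots](q)}=T_qM\qquad\text{for all } q\in M .$$ Then the system is globally approximate controllable, that is, $\overline{\mathcal{R}(q_0)}=M$ for every $q_0\in M$.
   Context: A Banach manifold modelled on $E$ is a paracompact Hausdorff space with charts that are bijections onto open subsets of $E$ and have smooth transition maps. A Banach space $E$ is called smooth if there exists a non-trivial Lipschitz $C^1$-smooth bump function on $E$ (a function with bounded support). A control $u(t)=(u_1(t),u_2(t),\ldots)$ is admissible if it is piecewise constant and at each $t$ only finitely many components $u_i(t)$ are different from zero, these taking values $+1$ or $-1$. The set of admissible controls is $\mathcal{U}$. For $q_0\in M$ and $u\in\mathcal U$, $q(t;q_0,u)$ denotes the (at least locally existing, unique) solution of the control system with $q(0)=q_0$, called a trajectory. The reachability set is $\mathcal R(q_0)=\{q(t;q_0,u): t\ge 0,\ u\in\mathcal U\}$ (all points of all trajectories starting at $q_0$, for those $t$ for which they exist). The Lie bracket of vector fields $V,W$ is the vector field $[V,W]$ whose action on functions $\varphi$ is $V(W\varphi)-W(V\varphi)$, where $(V\varphi)(q)=\varphi_*(q)V(q)$. Define $$\mathcal{L}[V_1,V_2,\ldots](q)=\mathrm{span}\{B(V_{i_1},V_{i_2},\ldots,V_{i_k})(q): k=1,2,\ldots\},$$ where $B(V_{i_1},\ldots,V_{i_k})$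 ranges over all iterated Lie bracket expressions in the vector fields $V_i$ (for $k=1$, the vector fields $V_i$ themselves). The closure of $\mathcal{L}[V_1,V_2,\ldots](q)$ is taken in $T_qM$. *)

theory Defs
  imports "HOL-Analysis.Analysis"
begin

section \<open>Smooth maps between open subsets of normed spaces\<close>

text \<open>
  A bounded \<open>k\<close>-linear map is represented as a function on lists, of which only the lists of
  length \<open>k\<close> matter.
\<close>

definition bounded_multilinear ::
    "nat \<Rightarrow> ('e::real_normed_vector list \<Rightarrow> 'f::real_normed_vector) \<Rightarrow> bool" where
  "bounded_multilinear k T \<longleftrightarrow>
     (\<forall>vs i. length vs = k \<and> i < k \<longrightarrow> linear (\<lambda>v. T (vs[i := v]))) \<and>
     (\<exists>C. \<forall>vs. length vs = k \<longrightarrow> norm (T vs) \<le> C * prod_list (map norm vs))"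

text \<open>
  The spaces of bounded \<open>k\<close>-linear maps have different types for different \<open>k\<close>, so a
  \<open>C\<^sup>\<infinity>\<close> map is described by its tower of Frechet derivatives \<open>D k x\<close>, each a bounded
  \<open>k\<close>-linear map. The inequality says that \<open>x \<mapsto> D k x\<close> is Frechet differentiable for the
  operator norm on \<open>k\<close>-linear maps, with derivative \<open>h \<mapsto> (vs \<mapsto> D (k + 1) x (h # vs))\<close>.
  Meant for open \<open>S\<close>.
\<close>

definition smooth_on ::
    "'e::real_normed_vector set \<Rightarrow> ('e \<Rightarrow> 'f::real_normed_vector) \<Rightarrow> bool" where
  "smooth_on S f \<longleftrightarrow>
     (\<exists>D :: nat \<Rightarrow> 'e \<Rightarrow> 'e list \<Rightarrow> 'f.
        (\<forall>x\<in>S. D 0 x [] = f x) \<and>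
        (\<forall>k. \<forall>x\<in>S. bounded_multilinear k (D k x)) \<and>
        (\<forall>k. \<forall>x\<in>S. \<forall>\<epsilon>>0. \<forall>\<^sub>F y in nhds x. \<forall>vs. length vs = k \<longrightarrow>
            norm (D k y vs - D k x vs - D (Suc k) x ((y - x) # vs))
              \<le> \<epsilon> * norm (y - x) * prod_list (map norm vs)))"


section \<open>Smooth Banach spaces\<close>

definition lipschitz_C1_bump :: "('e::real_normed_vector \<Rightarrow> real) \<Rightarrow> bool" where
  "lipschitz_C1_bump b \<longleftrightarrow>
     (\<exists>x. b x \<noteq> 0) \<and> bounded {x. b x \<noteq> 0} \<and> (\<exists>C. C-lipschitz_on UNIV b) \<and>
     (\<exists>b' :: 'e \<Rightarrow> 'e \<Rightarrow>\<^sub>L real.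
        (\<forall>x. (b has_derivative blinfun_apply (b' x)) (at x)) \<and> continuous_on UNIV b')"

definition smooth_banach_space :: "'e::banach itself \<Rightarrow> bool" where
  "smooth_banach_space _ \<longleftrightarrow> (\<exists>b :: 'e \<Rightarrow> real. lipschitz_C1_bump b)"

definition infinite_dimensional :: "'e::real_vector itself \<Rightarrow> bool" where
  "infinite_dimensional _ \<longleftrightarrow> \<not> (\<exists>B :: 'e set. finite B \<and> span B = UNIV)"


section \<open>Banach manifolds\<close>

text \<open>
  A chart is a pair \<open>(U, \<phi>)\<close> of a domain and a map; the values of \<open>\<phi>\<close> outside \<open>U\<close> are irrelevant.
\<close>

type_synonym ('m, 'e) chart = "'m set \<times> ('m \<Rightarrow> 'e)"

abbreviation chart_inv :: "('m, 'e) chart \<Rightarrow> 'e \<Rightarrow> 'm" where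
  "chart_inv c \<equiv> inv_into (fst c) (snd c)"

definition paracompact_space :: "'m topology \<Rightarrow> bool" where
  "paracompact_space X \<longleftrightarrow>
     (\<forall>\<U>. (\<forall>U\<in>\<U>. openin X U) \<and> \<Union>\<U> = topspace X \<longrightarrow>
        (\<exists>\<V>. (\<forall>V\<in>\<V>. openin X V \<and> (\<exists>U\<in>\<U>. V \<subseteq> U)) \<and> \<Union>\<V> = topspace X \<and>
             locally_finite_in X \<V>))"

definition banach_manifold :: "'m topology \<Rightarrow> ('m, 'e::banach) chart set \<Rightarrow> bool" where
  "banach_manifold X A \<longleftrightarrow>
     Hausdorff_space X \<and> paracompact_space X \<and>
     \<Union>(fst ` A) = topspace X \<and>
     (\<forall>(U, \<phi>)\<in>A. openin X U \<and> open (\<phi> ` U) \<and>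
        homeomorphic_map (subtopology X U) (top_of_set (\<phi> ` U)) \<phi>) \<and>
     (\<forall>c\<in>A. \<forall>d\<in>A. smooth_on (snd c ` (fst c \<inter> fst d)) (snd d \<circ> chart_inv c))"

text \<open>
  A tangent vector at \<open>q\<close> is given by its coordinates in every chart around \<open>q\<close>, which are related
  by the derivatives of the transition maps. Coordinates in all other charts are \<open>0\<close> by convention,
  so that equal tangent vectors are equal as functions.
\<close>

type_synonym ('m, 'e) tangent = "('m, 'e) chart \<Rightarrow> 'e"

definition charts_at :: "('m, 'e) chart set \<Rightarrow> 'm \<Rightarrow> ('m, 'e) chart set" where
  "charts_at A q = {c \<in> A. q \<in> fst c}"

definition tangent_space ::
    "('m, 'e::real_normed_vector) chart set \<Rightarrow> 'm \<Rightarrow> ('m, 'e) tangent set" where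
  "tangent_space A q =
     {v. (\<forall>c. c \<notin> charts_at A q \<longrightarrow> v c = 0) \<and>
         (\<forall>c\<in>charts_at A q. \<forall>d\<in>charts_at A q.
            v d = frechet_derivative (snd d \<circ> chart_inv c) (at (snd c q)) (v c))}"

text \<open>
  The topology of \<open>T\<^sub>qM\<close> is the initial one for the coordinate maps \<open>v \<mapsto> v c\<close>; each of them is then
  a linear homeomorphism onto the model space.
\<close>

definition tangent_topology ::
    "('m, 'e::real_normed_vector) chart set \<Rightarrow> 'm \<Rightarrow> ('m, 'e) tangent topology" where
  "tangent_topology A q =
     topology_generated_by
       {{v \<in> tangent_space A q. v c \<in> W} | c W. c \<in> charts_at A q \<and> open W}"

definition tangent_span :: "('m, 'e::real_vector) tangent set \<Rightarrow> ('m, 'e) tangent set" where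
  "tangent_span B = {\<lambda>c. \<Sum>w\<in>F. a w *\<^sub>R w c | F a. finite F \<and> F \<subseteq> B}"


section \<open>Vector fields and Lie brackets\<close>

definition smooth_vector_field ::
    "'m topology \<Rightarrow> ('m, 'e::real_normed_vector) chart set \<Rightarrow> ('m \<Rightarrow> ('m, 'e) tangent) \<Rightarrow> bool" where
  "smooth_vector_field X A V \<longleftrightarrow>
     (\<forall>q\<in>topspace X. V q \<in> tangent_space A q) \<and>
     (\<forall>c\<in>A. smooth_on (snd c ` fst c) (\<lambda>x. V (chart_inv c x) c))"

definition smooth_function_on ::
    "('m, 'e::real_normed_vector) chart set \<Rightarrow> 'm set \<Rightarrow> ('m \<Rightarrow> real) \<Rightarrow> bool" where
  "smooth_function_on A N f \<longleftrightarrow> (\<forall>c\<in>A. smooth_on (snd c ` (fst c \<inter> N)) (f \<circ> chart_inv c))"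

text \<open>
  The function \<open>V f\<close>, that is \<open>q \<mapsto> f\<^sub>*(q) V(q)\<close>, computed in some chart around \<open>q\<close>; by the
  transformation law of tangent vectors the value does not depend on the chart. Only the germ of
  \<open>f\<close> at \<open>q\<close> matters.
\<close>

definition vf_action ::
    "('m, 'e::real_normed_vector) chart set \<Rightarrow> ('m \<Rightarrow> ('m, 'e) tangent) \<Rightarrow> ('m \<Rightarrow> real) \<Rightarrow> 'm \<Rightarrow> real" where
  "vf_action A V f q =
     (let c = (SOME c. c \<in> charts_at A q)
      in frechet_derivative (f \<circ> chart_inv c) (at (snd c q)) (V q c))"

text \<open>
  \<open>Z\<close> is the Lie bracket of \<open>V\<close> and \<open>W\<close>. The test functions are smooth functions on open subsets
  of the manifold: a Banach manifold may have too few globally defined smooth functions to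
  determine a vector field.
\<close>

definition is_lie_bracket ::
    "'m topology \<Rightarrow> ('m, 'e::real_normed_vector) chart set \<Rightarrow>
     ('m \<Rightarrow> ('m, 'e) tangent) \<Rightarrow> ('m \<Rightarrow> ('m, 'e) tangent) \<Rightarrow> ('m \<Rightarrow> ('m, 'e) tangent) \<Rightarrow> bool" where
  "is_lie_bracket X A V W Z \<longleftrightarrow>
     smooth_vector_field X A Z \<and>
     (\<forall>N f. openin X N \<and> smooth_function_on A N f \<longrightarrow>
        (\<forall>q\<in>N. vf_action A Z f q =
            vf_action A V (vf_action A W f) q - vf_action A W (vf_action A V f) q))"

inductive_set iterated_brackets ::
    "'m topology \<Rightarrow> ('m, 'e::real_normed_vector) chart set \<Rightarrow> (nat \<Rightarrow> 'm \<Rightarrow> ('m, 'e) tangent) \<Rightarrow>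
     ('m \<Rightarrow> ('m, 'e) tangent) set"
  for X A V where
  generator: "V i \<in> iterated_brackets X A V"
| bracket: "\<lbrakk>B \<in> iterated_brackets X A V; C \<in> iterated_brackets X A V; is_lie_bracket X A B C Z\<rbrakk>
    \<Longrightarrow> Z \<in> iterated_brackets X A V"

definition lie_span ::
    "'m topology \<Rightarrow> ('m, 'e::real_normed_vector) chart set \<Rightarrow> (nat \<Rightarrow> 'm \<Rightarrow> ('m, 'e) tangent) \<Rightarrow>
     'm \<Rightarrow> ('m, 'e) tangent set" where
  "lie_span X A V q = tangent_span ((\<lambda>B. B q) ` iterated_brackets X A V)"


section \<open>Controls, trajectories and reachable sets\<close>

text \<open>
  The control value at time \<open>t\<close> is the sequence \<open>u t\<close>; only times \<open>t \<ge> 0\<close> matter. Piecewise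
  constant means finitely many breakpoints in each bounded time interval (the set \<open>F\<close>), with
  arbitrary admissible values at the breakpoints themselves.
\<close>

definition piecewise_constant :: "(real \<Rightarrow> 'a) \<Rightarrow> bool" where
  "piecewise_constant u \<longleftrightarrow>
     (\<forall>T. \<exists>F. finite F \<and>
        (\<forall>s t. 0 \<le> s \<and> s \<le> t \<and> t \<le> T \<and> {s..t} \<inter> F = {} \<longrightarrow> u s = u t))"

definition admissible_control :: "(real \<Rightarrow> nat \<Rightarrow> real) \<Rightarrow> bool" where
  "admissible_control u \<longleftrightarrow>
     piecewise_constant u \<and>
     (\<forall>t\<ge>0. finite {i. u t i \<noteq> 0} \<and> (\<forall>i. u t i \<in> {-1, 0, 1}))"

text \<open>
  A solution on \<open>{0..T}\<close> of the control system with initial value \<open>q0\<close>: a continuous curve that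
  satisfies the equation, read in all charts, at all but finitely many times (the velocity may jump
  where the control does).
\<close>

definition trajectory ::
    "'m topology \<Rightarrow> ('m, 'e::real_normed_vector) chart set \<Rightarrow> (nat \<Rightarrow> 'm \<Rightarrow> ('m, 'e) tangent) \<Rightarrow>
     (real \<Rightarrow> nat \<Rightarrow> real) \<Rightarrow> 'm \<Rightarrow> real \<Rightarrow> (real \<Rightarrow> 'm) \<Rightarrow> bool" where
  "trajectory X A V u q0 T q \<longleftrightarrow>
     continuous_map (top_of_set {0..T}) X q \<and> q 0 = q0 \<and>
     (\<exists>F. finite F \<and>
        (\<forall>t\<in>{0..T} - F. \<forall>c\<in>charts_at A (q t).
           ((snd c \<circ> q) has_vector_derivative (\<Sum>i | u t i \<noteq> 0. u t i *\<^sub>R V i (q t) c))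
             (at t within {0..T})))"

definition reachable_set ::
    "'m topology \<Rightarrow> ('m, 'e::real_normed_vector) chart set \<Rightarrow> (nat \<Rightarrow> 'm \<Rightarrow> ('m, 'e) tangent) \<Rightarrow>
     'm \<Rightarrow> 'm set" where
  "reachable_set X A V q0 =
     {q T | q T u. T \<ge> 0 \<and> admissible_control u \<and> trajectory X A V u q0 T q}"

definition globally_approx_controllable ::
    "'m topology \<Rightarrow> ('m, 'e::real_normed_vector) chart set \<Rightarrow> (nat \<Rightarrow> 'm \<Rightarrow> ('m, 'e) tangent) \<Rightarrow> bool" where
  "globally_approx_controllable X A V \<longleftrightarrow>
     (\<forall>q0\<in>topspace X. X closure_of (reachable_set X A V q0) = topspace X)"

end

theory Submission
  imports Defs
begin

text \<open>
  The reachable set \<open>R\<close> of a point \<open>q0\<close> is not empty, and its closure is closed. On a connected manifold it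
  therefore suffices to show that the closure is also open, which is a local question and can be settled in a
  chart, that is, for a subset \<open>S\<close> of the Banach space \<open>E\<close>.

  The central notion is uniform tangency of a vector field \<open>f\<close> to \<open>S\<close>: points of \<open>S\<close> can be found within \<open>o(h)\<close> of
  \<open>x + h f(x)\<close>, uniformly in \<open>x \<in> S\<close> near a given point and for both signs of \<open>h\<close>. The control fields \<open>V i\<close>
  have this property, as their integral curves can be appended to trajectories (\<open>generator_tangent\<close>). The property
  passes to Lie brackets (\<open>uniformly_tangent_bracket\<close>): by many small steps, tangency of first order implies
  that the second-order Taylor polynomial of the flow of \<open>f\<close> is \<open>O(h\<^sup>3)\<close>-close to \<open>S\<close> (\<open>second_order_tangent_step\<close>),
  and then the usual commutator of four such steps over the time \<open>t\<close> moves by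
  \<open>t\<^sup>2 [f, g] + O(t\<^sup>3)\<close>. The property also passes to linear combinations
  (\<open>lipschitz_tangent_sum\<close>). As the span of the iterated brackets is dense in each tangent space, every
  direction is contingent to the closure of \<open>S\<close> at each of its points (\<open>contingent_cone_full\<close>).

  A closed set with this property is open (\<open>contingent_cone_full_imp_ball_subset_closure\<close>). If a point \<open>z\<close> close to
  the set were outside it, then Ekeland's variational principle would give a point \<open>s\<close> of the set at which the distance
  to \<open>z\<close> cannot be decreased at rate one half, whereas moving in the contingent direction \<open>z - s\<close> decreases it at rate
  almost one.

  Brackets are defined by their action on smooth functions. Their coordinate formula is obtained by testing with
  bounded functionals (\<open>bracket_in_coordinates\<close>); derivatives of a bump function provide enough functionals to
  separate the points of \<open>E\<close> (\<open>bump_separates_points\<close>).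
\<close>

section \<open>Sets that are tangent to vector fields\<close>

text \<open>
  Expansions of a field along itself and along a second field need quantitative control up to second
  order, with one constant \<open>K\<close> on a whole ball.
\<close>

definition C11_on :: "'e::real_normed_vector set \<Rightarrow> ('e \<Rightarrow> 'e) \<Rightarrow> ('e \<Rightarrow> 'e \<Rightarrow> 'e) \<Rightarrow> real \<Rightarrow> bool" where
  "C11_on B f f' K \<longleftrightarrow> 0 \<le> K \<and>
     (\<forall>x\<in>B. bounded_linear (f' x) \<and> norm (f x) \<le> K \<and> (\<forall>v. norm (f' x v) \<le> K * norm v)) \<and>
     (\<forall>x\<in>B. \<forall>y\<in>B. norm (f y - f x) \<le> K * norm (y - x) \<and>
        norm (f y - f x - f' x (y - x)) \<le> K * (norm (y - x))\<^sup>2 \<and>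
        (\<forall>v. norm (f' y v - f' x v) \<le> K * norm (y - x) * norm v))"

text \<open>
  From every \<open>x \<in> S\<close> the straight step \<open>x + h f(x)\<close> stays within \<open>o(h)\<close> of \<open>S\<close>, uniformly over
  \<open>x \<in> S \<inter> B\<close> and in both time directions. The uniformity is what allows many small steps to be composed.
\<close>

definition uniformly_tangent :: "'e::real_normed_vector set \<Rightarrow> ('e \<Rightarrow> 'e) \<Rightarrow> 'e set \<Rightarrow> bool" where
  "uniformly_tangent S f B \<longleftrightarrow>
     (\<forall>\<epsilon>>0. \<exists>\<delta>>0. \<forall>x\<in>S \<inter> B. \<forall>h. \<bar>h\<bar> \<le> \<delta> \<longrightarrow> (\<exists>y\<in>S. norm (y - x - h *\<^sub>R f x) \<le> \<epsilon> * \<bar>h\<bar>))"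

lemma uniformly_tangentD:
  assumes "uniformly_tangent S f B" "0 < \<epsilon>"
  obtains \<delta> where "0 < \<delta>"
    "\<And>x h. x \<in> S \<Longrightarrow> x \<in> B \<Longrightarrow> \<bar>h\<bar> \<le> \<delta> \<Longrightarrow> \<exists>y\<in>S. norm (y - x - h *\<^sub>R f x) \<le> \<epsilon> * \<bar>h\<bar>"
proof -
  obtain \<delta> where "0 < \<delta>"
    "\<forall>x\<in>S \<inter> B. \<forall>h. \<bar>h\<bar> \<le> \<delta> \<longrightarrow> (\<exists>y\<in>S. norm (y - x - h *\<^sub>R f x) \<le> \<epsilon> * \<bar>h\<bar>)"
    using assms unfolding uniformly_tangent_def by blast
  then show ?thesis using that[of \<delta>] by auto
qed

lemma uniformly_tangentI:
  assumes "\<And>\<epsilon>. 0 < \<epsilon> \<Longrightarrow> \<exists>\<delta>>0. \<forall>x h. x \<in> S \<longrightarrow> x \<in> B \<longrightarrow> \<bar>h\<bar> \<le> \<delta> \<longrightarrow>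
    (\<exists>y\<in>S. norm (y - x - h *\<^sub>R f x) \<le> \<epsilon> * \<bar>h\<bar>)"
  shows "uniformly_tangent S f B"
  unfolding uniformly_tangent_def
proof (intro allI impI)
  fix \<epsilon> :: real assume "0 < \<epsilon>"
  then obtain \<delta> where "0 < \<delta>" "\<forall>x h. x \<in> S \<longrightarrow> x \<in> B \<longrightarrow> \<bar>h\<bar> \<le> \<delta> \<longrightarrow>
    (\<exists>y\<in>S. norm (y - x - h *\<^sub>R f x) \<le> \<epsilon> * \<bar>h\<bar>)" using assms by blast
  then show "\<exists>\<delta>>0. \<forall>x\<in>S \<inter> B. \<forall>h. \<bar>h\<bar> \<le> \<delta> \<longrightarrow> (\<exists>y\<in>S. norm (y - x - h *\<^sub>R f x) \<le> \<epsilon> * \<bar>h\<bar>)"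
    by (intro exI[of _ \<delta>]) simp
qed

lemma C11_onD:
  assumes "C11_on B f f' K" "x \<in> B"
  shows "0 \<le> K" "bounded_linear (f' x)" "norm (f x) \<le> K" "norm (f' x v) \<le> K * norm v"
  using assms by (auto simp: C11_on_def)

lemma C11_onD2:
  assumes "C11_on B f f' K" "x \<in> B" "y \<in> B"
  shows "norm (f y - f x) \<le> K * norm (y - x)"
    "norm (f y - f x - f' x (y - x)) \<le> K * (norm (y - x))\<^sup>2"
    "norm (f' y v - f' x v) \<le> K * norm (y - x) * norm v"
  using assms by (auto simp: C11_on_def)

lemma C11_on_mono:
  assumes "C11_on B f f' K" "K \<le> L" "B' \<subseteq> B"
  shows "C11_on B' f f' L"
proof -
  have *: "a \<le> L * b" if "a \<le> K * b" "0 \<le> b" for a b :: real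
    using that assms(2) by (meson mult_right_mono order_trans)
  show ?thesis
    unfolding C11_on_def
  proof (intro conjI ballI allI)
    show "0 \<le> L" using assms by (auto simp: C11_on_def)
    fix x assume x: "x \<in> B'"
    then have xB: "x \<in> B" using assms by auto
    show "bounded_linear (f' x)" using C11_onD(2)[OF assms(1) xB] .
    show "norm (f x) \<le> L" using C11_onD(3)[OF assms(1) xB] assms by simp
    show "norm (f' x v) \<le> L * norm v" for v
      by (rule *[OF C11_onD(4)[OF assms(1) xB]]) simp
    fix y assume "y \<in> B'"
    then have yB: "y \<in> B" using assms by auto
    show "norm (f y - f x) \<le> L * norm (y - x)"
      by (rule *[OF C11_onD2(1)[OF assms(1) xB yB]]) simp
    show "norm (f y - f x - f' x (y - x)) \<le> L * (norm (y - x))\<^sup>2"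
      by (rule *[OF C11_onD2(2)[OF assms(1) xB yB]]) simp
    show "norm (f' y v - f' x v) \<le> L * norm (y - x) * norm v" for v
      using *[of "norm (f' y v - f' x v)" "norm (y - x) * norm v"]
        C11_onD2(3)[OF assms(1) xB yB, of v] by (simp add: mult.assoc)
  qed
qed

lemma uniformly_tangent_subset:
  "uniformly_tangent S f B \<Longrightarrow> B' \<subseteq> B \<Longrightarrow> uniformly_tangent S f B'"
  unfolding uniformly_tangent_def
proof (intro allI impI)
  fix \<epsilon> :: real
  assume tan: "\<forall>\<epsilon>>0. \<exists>\<delta>>0. \<forall>x\<in>S \<inter> B. \<forall>h. \<bar>h\<bar> \<le> \<delta> \<longrightarrow> (\<exists>y\<in>S. norm (y - x - h *\<^sub>R f x) \<le> \<epsilon> * \<bar>h\<bar>)"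
    and "B' \<subseteq> B" "0 < \<epsilon>"
  then obtain \<delta> where "0 < \<delta>"
    "\<forall>x\<in>S \<inter> B. \<forall>h. \<bar>h\<bar> \<le> \<delta> \<longrightarrow> (\<exists>y\<in>S. norm (y - x - h *\<^sub>R f x) \<le> \<epsilon> * \<bar>h\<bar>)" by blast
  with \<open>B' \<subseteq> B\<close> show "\<exists>\<delta>>0. \<forall>x\<in>S \<inter> B'. \<forall>h. \<bar>h\<bar> \<le> \<delta> \<longrightarrow> (\<exists>y\<in>S. norm (y - x - h *\<^sub>R f x) \<le> \<epsilon> * \<bar>h\<bar>)"
    by (intro exI[of _ \<delta>]) auto
qed

lemma norm_add_le4:
  fixes a b c d :: "'a::real_normed_vector"
  assumes "norm a \<le> A" "norm b \<le> B" "norm c \<le> C" "norm d \<le> D"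
  shows "norm (a + b + c + d) \<le> A + B + C + D"
  using assms norm_triangle_ineq[of "a+b+c" d] norm_triangle_ineq[of "a+b" c]
    norm_triangle_ineq[of a b] by linarith

lemma norm_add_le5:
  fixes a b c d e :: "'a::real_normed_vector"
  assumes "norm a \<le> A" "norm b \<le> B" "norm c \<le> C" "norm d \<le> D" "norm e \<le> E"
  shows "norm (a + b + c + d + e) \<le> A + B + C + D + E"
  using assms norm_add_le4[of a A b B c C d D] norm_triangle_ineq[of "a+b+c+d" e] by linarith

text \<open>
  First-order tangency improves itself: divide the time \<open>h\<close> into \<open>N\<close> equal parts and follow the
  tangent steps with relative error \<open>h\<^sup>2\<close>. The resulting Euler polygon has its corners in \<open>S\<close>, and for large
  \<open>N\<close> it agrees with the second-order Taylor polynomial of the flow up to \<open>O(h\<^sup>3)\<close>. Three bounds are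
  propagated along the polygon, of orders \<open>h\<close>, \<open>h\<^sup>2\<close> and \<open>h\<^sup>3\<close>; each uses the previous one, so that
  the errors of the single steps simply add up.
\<close>

lemma second_order_tangent_step:
  fixes f :: "'e::real_normed_vector \<Rightarrow> 'e"
  assumes f: "C11_on (ball p r) f f' K" and tan: "uniformly_tangent S f (ball p r)" and r: "0 < r"
  obtains C \<delta> where "0 < \<delta>" "0 \<le> C"
    "\<And>x h. x \<in> S \<Longrightarrow> x \<in> ball p (r/2) \<Longrightarrow> \<bar>h\<bar> \<le> \<delta> \<Longrightarrow>
       \<exists>y\<in>S. norm (y - x - h *\<^sub>R f x - (h\<^sup>2 / 2) *\<^sub>R f' x (f x)) \<le> C * \<bar>h\<bar> ^ 3"
proof -
  have K: "0 \<le> K" using f by (simp add: C11_on_def)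
  define L where "L = K + 1"
  have L: "1 \<le> L" using K by (simp add: L_def)
  define C1 where "C1 = 1 + K * L"
  define C2 where "C2 = 1 + K * L\<^sup>2 + K * C1 + K\<^sup>2"
  have C1: "0 \<le> C1" and C2: "0 \<le> C2" using K L by (simp_all add: C1_def C2_def)
  define \<delta> where "\<delta> = min 1 (r / (2 * L))"
  have \<delta>: "0 < \<delta>" using r L by (simp add: \<delta>_def)
  have "\<exists>y\<in>S. norm (y - x - h *\<^sub>R f x - (h\<^sup>2 / 2) *\<^sub>R f' x (f x)) \<le> C2 * \<bar>h\<bar> ^ 3"
    if x: "x \<in> S" "x \<in> ball p (r/2)" and h: "\<bar>h\<bar> \<le> \<delta>" for x h
  proof (cases "h = 0")
    case True
    then show ?thesis using x by (intro bexI[of _ x]) auto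
  next
    case False
    have h1: "\<bar>h\<bar> \<le> 1" and hL: "\<bar>h\<bar> * L \<le> r / 2"
      using h L by (auto simp: \<delta>_def field_simps)
    have h2h: "h\<^sup>2 \<le> \<bar>h\<bar>" using h1
      by (metis abs_ge_zero mult_left_le power2_abs power2_eq_square)
    have h2: "0 < h\<^sup>2" "h\<^sup>2 \<le> 1" using False h2h h1 by auto
    obtain \<delta>' where \<delta>': "0 < \<delta>'" and step: "\<And>y \<tau>. y \<in> S \<Longrightarrow> y \<in> ball p r \<Longrightarrow> \<bar>\<tau>\<bar> \<le> \<delta>' \<Longrightarrow>
        \<exists>z\<in>S. norm (z - y - \<tau> *\<^sub>R f y) \<le> h\<^sup>2 * \<bar>\<tau>\<bar>"
    proof -
      obtain \<delta>' where "0 < \<delta>'" "\<forall>y\<in>S \<inter> ball p r. \<forall>\<tau>. \<bar>\<tau>\<bar> \<le> \<delta>' \<longrightarrow>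
          (\<exists>z\<in>S. norm (z - y - \<tau> *\<^sub>R f y) \<le> h\<^sup>2 * \<bar>\<tau>\<bar>)"
        using tan[unfolded uniformly_tangent_def, rule_format, OF h2(1)] by blast
      then show ?thesis by (intro that[of \<delta>']) auto
    qed
    \<comment> \<open>The polygon needs steps short enough for the tolerance \<open>h\<^sup>2\<close> of \<open>step\<close>; their bound by \<open>h\<^sup>2\<close>
      makes the terms quadratic in \<open>\<tau>\<close> negligible.\<close>
    have "0 < min \<delta>' (h\<^sup>2)" using \<delta>' h2 by simp
    then obtain N0 where N0: "\<bar>h\<bar> / min \<delta>' (h\<^sup>2) < real N0" using reals_Archimedean2 by blast
    define N where "N = Suc N0"
    have N: "0 < N" "\<bar>h\<bar> / min \<delta>' (h\<^sup>2) \<le> real N" using N0 by (auto simp: N_def)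
    define \<tau> where "\<tau> = h / real N"
    have \<tau>: "\<bar>\<tau>\<bar> \<le> \<delta>'" "\<bar>\<tau>\<bar> \<le> h\<^sup>2"
    proof -
      have "\<bar>h\<bar> \<le> real N * min \<delta>' (h\<^sup>2)"
        using N(2) \<open>0 < min \<delta>' (h\<^sup>2)\<close> by (simp add: pos_divide_le_eq)
      then have "\<bar>h\<bar> / real N \<le> min \<delta>' (h\<^sup>2)"
        by (metis N(1) mult.commute of_nat_0_less_iff pos_divide_le_eq)
      then show "\<bar>\<tau>\<bar> \<le> \<delta>'" "\<bar>\<tau>\<bar> \<le> h\<^sup>2" by (simp_all add: \<tau>_def)
    qed
    have N\<tau>: "real N * \<bar>\<tau>\<bar> = \<bar>h\<bar>" "real N * \<tau> = h"
      using N(1) unfolding \<tau>_def abs_divide by auto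
    have xr: "x \<in> ball p r" using x r by auto
    note fx = C11_onD[OF f xr]
    interpret f': bounded_linear "f' x" by (rule fx(2))
    have "\<exists>y\<in>S. norm (y - x) \<le> real k * \<bar>\<tau>\<bar> * L \<and>
        norm (y - x - (real k * \<tau>) *\<^sub>R f x) \<le> real k * \<bar>\<tau>\<bar> * (C1 * \<bar>h\<bar>) \<and>
        norm (y - x - (real k * \<tau>) *\<^sub>R f x - ((real k * \<tau>)\<^sup>2 / 2) *\<^sub>R f' x (f x))
          \<le> real k * \<bar>\<tau>\<bar> * (C2 * h\<^sup>2)" if "k \<le> N" for k
      using that
    proof (induction k)
      case 0
      then show ?case using x by (intro bexI[of _ x]) auto
    next
      case (Suc k)
      define s where "s = real k * \<tau>"
      obtain y where y: "y \<in> S" and ya: "norm (y - x) \<le> real k * \<bar>\<tau>\<bar> * L"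
        and yb: "norm (y - x - s *\<^sub>R f x) \<le> real k * \<bar>\<tau>\<bar> * (C1 * \<bar>h\<bar>)"
        and yc: "norm (y - x - s *\<^sub>R f x - (s\<^sup>2 / 2) *\<^sub>R f' x (f x)) \<le> real k * \<bar>\<tau>\<bar> * (C2 * h\<^sup>2)"
        using Suc unfolding s_def by auto
      have k\<tau>: "real k * \<bar>\<tau>\<bar> \<le> \<bar>h\<bar>"
        using Suc.prems unfolding N\<tau>(1)[symmetric] by (intro mult_right_mono) auto
      have yx: "norm (y - x) \<le> \<bar>h\<bar> * L"
        using ya mult_right_mono[OF k\<tau>, of L] L by linarith
      have yx1: "norm (y - x - s *\<^sub>R f x) \<le> \<bar>h\<bar> * (C1 * \<bar>h\<bar>)"
        using yb mult_right_mono[OF k\<tau>, of "C1 * \<bar>h\<bar>"] C1 by simp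
      have "dist p y \<le> dist p x + norm (y - x)"
        by (metis dist_commute dist_norm dist_triangle)
      then have yr: "y \<in> ball p r" using x yx hL by (auto)
      obtain z where z: "z \<in> S" "norm (z - y - \<tau> *\<^sub>R f y) \<le> h\<^sup>2 * \<bar>\<tau>\<bar>"
        using step[OF y yr \<tau>(1)] by blast
      note fxy = C11_onD2[OF f xr yr] and fy = C11_onD[OF f yr]
      have s: "real (Suc k) * \<tau> = s + \<tau>" "real (Suc k) * \<bar>\<tau>\<bar> = real k * \<bar>\<tau>\<bar> + \<bar>\<tau>\<bar>"
        by (auto simp: s_def algebra_simps)
      have \<tau>f: "norm (\<tau> *\<^sub>R f y) \<le> \<bar>\<tau>\<bar> * K" using fy(3) by (simp add: mult_left_mono)
      have h2\<tau>: "h\<^sup>2 * \<bar>\<tau>\<bar> \<le> \<bar>\<tau>\<bar>" using h2 by (simp add: mult_left_le_one_le)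
      have "norm (z - x) = norm ((y - x) + (z - y - \<tau> *\<^sub>R f y) + \<tau> *\<^sub>R f y + 0)"
        by (simp add: algebra_simps)
      also have "\<dots> \<le> real k * \<bar>\<tau>\<bar> * L + h\<^sup>2 * \<bar>\<tau>\<bar> + \<bar>\<tau>\<bar> * K + 0"
        by (rule norm_add_le4) (use ya z \<tau>f in auto)
      finally have A: "norm (z - x) \<le> (real k * \<bar>\<tau>\<bar> + \<bar>\<tau>\<bar>) * L"
        using h2\<tau> by (simp add: L_def algebra_simps)
      have lip: "norm (\<tau> *\<^sub>R (f y - f x)) \<le> \<bar>\<tau>\<bar> * (K * (\<bar>h\<bar> * L))"
        using order_trans[OF fxy(1) mult_left_mono[OF yx K]] by (simp add: mult_left_mono)
      have "norm (z - x - (s + \<tau>) *\<^sub>R f x)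
          = norm ((y - x - s *\<^sub>R f x) + (z - y - \<tau> *\<^sub>R f y) + \<tau> *\<^sub>R (f y - f x) + 0)"
        by (simp add: algebra_simps)
      also have "\<dots> \<le> real k * \<bar>\<tau>\<bar> * (C1 * \<bar>h\<bar>) + h\<^sup>2 * \<bar>\<tau>\<bar> + \<bar>\<tau>\<bar> * (K * (\<bar>h\<bar> * L)) + 0"
        by (rule norm_add_le4) (use yb z lip in auto)
      also have "\<dots> \<le> (real k * \<bar>\<tau>\<bar> + \<bar>\<tau>\<bar>) * (C1 * \<bar>h\<bar>)"
        using mult_right_mono[OF h2h, of "\<bar>\<tau>\<bar>"] by (simp add: C1_def algebra_simps)
      finally have B: "norm (z - x - (s + \<tau>) *\<^sub>R f x) \<le> (real k * \<bar>\<tau>\<bar> + \<bar>\<tau>\<bar>) * (C1 * \<bar>h\<bar>)" .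
      have yx2: "(norm (y - x))\<^sup>2 \<le> h\<^sup>2 * L\<^sup>2"
        using power_mono[OF yx, of 2] by (simp add: power_mult_distrib)
      have t1: "norm (\<tau> *\<^sub>R (f y - f x - f' x (y - x))) \<le> \<bar>\<tau>\<bar> * (K * (h\<^sup>2 * L\<^sup>2))"
        using order_trans[OF fxy(2) mult_left_mono[OF yx2 K]] by (simp add: mult_left_mono)
      have t2: "norm (\<tau> *\<^sub>R f' x (y - x - s *\<^sub>R f x)) \<le> \<bar>\<tau>\<bar> * (K * (\<bar>h\<bar> * (C1 * \<bar>h\<bar>)))"
        using order_trans[OF fx(4) mult_left_mono[OF yx1 K]] by (simp add: mult_left_mono)
      have ff: "norm (f' x (f x)) \<le> K * K"
        using order_trans[OF fx(4) mult_left_mono[OF fx(3) K]] .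
      have "norm (- ((\<tau>\<^sup>2 / 2) *\<^sub>R f' x (f x))) \<le> (\<tau>\<^sup>2 / 2) * (K * K)"
        using mult_left_mono[OF ff, of "\<tau>\<^sup>2 / 2"] by simp
      also have "\<dots> \<le> (\<bar>\<tau>\<bar> * h\<^sup>2) * (K * K)"
      proof (rule mult_right_mono)
        have "\<tau>\<^sup>2 = \<bar>\<tau>\<bar> * \<bar>\<tau>\<bar>" by (simp add: power2_eq_square)
        also have "\<dots> \<le> \<bar>\<tau>\<bar> * h\<^sup>2" using \<tau>(2) by (intro mult_left_mono) auto
        finally show "\<tau>\<^sup>2 / 2 \<le> \<bar>\<tau>\<bar> * h\<^sup>2" using zero_le_power2[of \<tau>] by linarith
      qed (use K in auto)
      finally have t3: "norm (- ((\<tau>\<^sup>2 / 2) *\<^sub>R f' x (f x))) \<le> (\<bar>\<tau>\<bar> * h\<^sup>2) * (K * K)" .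
      have e1: "((s + \<tau>)\<^sup>2 / 2) *\<^sub>R f' x (f x)
          = (s\<^sup>2 / 2) *\<^sub>R f' x (f x) + (s * \<tau>) *\<^sub>R f' x (f x) + (\<tau>\<^sup>2 / 2) *\<^sub>R f' x (f x)"
        unfolding scaleR_left_distrib[symmetric]
        by (rule arg_cong[where f="\<lambda>c. c *\<^sub>R _"]) (simp add: power2_eq_square algebra_simps add_divide_distrib)
      have e2: "\<tau> *\<^sub>R f' x (y - x - s *\<^sub>R f x) = \<tau> *\<^sub>R f' x (y - x) - (s * \<tau>) *\<^sub>R f' x (f x)"
        by (simp add: f'.diff f'.scaleR scaleR_diff_right mult.commute)
      have "norm (z - x - (s + \<tau>) *\<^sub>R f x - ((s + \<tau>)\<^sup>2 / 2) *\<^sub>R f' x (f x))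
          = norm ((y - x - s *\<^sub>R f x - (s\<^sup>2 / 2) *\<^sub>R f' x (f x)) + (z - y - \<tau> *\<^sub>R f y)
              + \<tau> *\<^sub>R (f y - f x - f' x (y - x)) + \<tau> *\<^sub>R f' x (y - x - s *\<^sub>R f x)
              + (- ((\<tau>\<^sup>2 / 2) *\<^sub>R f' x (f x))))"
        unfolding e1 e2 by (simp add: algebra_simps)
      also have "\<dots> \<le> real k * \<bar>\<tau>\<bar> * (C2 * h\<^sup>2) + h\<^sup>2 * \<bar>\<tau>\<bar> + \<bar>\<tau>\<bar> * (K * (h\<^sup>2 * L\<^sup>2))
            + \<bar>\<tau>\<bar> * (K * (\<bar>h\<bar> * (C1 * \<bar>h\<bar>))) + (\<bar>\<tau>\<bar> * h\<^sup>2) * (K * K)"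
        by (rule norm_add_le5[OF yc z(2) t1 t2 t3])
      also have "\<bar>h\<bar> * (C1 * \<bar>h\<bar>) = C1 * h\<^sup>2" by (simp add: power2_eq_square)
      also have "real k * \<bar>\<tau>\<bar> * (C2 * h\<^sup>2) + h\<^sup>2 * \<bar>\<tau>\<bar> + \<bar>\<tau>\<bar> * (K * (h\<^sup>2 * L\<^sup>2))
            + \<bar>\<tau>\<bar> * (K * (C1 * h\<^sup>2)) + (\<bar>\<tau>\<bar> * h\<^sup>2) * (K * K)
          = (real k * \<bar>\<tau>\<bar> + \<bar>\<tau>\<bar>) * (C2 * h\<^sup>2)"
        by (simp add: C2_def algebra_simps power2_eq_square)
      finally show ?case using z(1) A B unfolding s by blast
    qed
    from this[of N] obtain y where y: "y \<in> S"
      "norm (y - x - h *\<^sub>R f x - (h\<^sup>2 / 2) *\<^sub>R f' x (f x)) \<le> \<bar>h\<bar> * (C2 * h\<^sup>2)"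
      unfolding N\<tau> by auto
    have "\<bar>h\<bar> * (C2 * h\<^sup>2) = C2 * \<bar>h\<bar> ^ 3"
      by (subst power2_abs[symmetric]) (simp only: power2_eq_square power3_eq_cube ac_simps)
    with y show ?thesis by auto
  qed
  with \<delta> C2 show ?thesis by (intro that[of \<delta> C2]) auto
qed

text \<open>
  The statement \<open>y = x + t a + t\<^sup>2 b + O(t\<^sup>3)\<close>, with one constant \<open>C\<close> that also bounds the
  coefficients, so that the growth of the error under composition depends on \<open>C\<close> alone.
\<close>

definition second_order_expansion ::
    "real \<Rightarrow> 'e::real_normed_vector \<Rightarrow> real \<Rightarrow> 'e \<Rightarrow> 'e \<Rightarrow> 'e \<Rightarrow> bool" where
  "second_order_expansion C x t y a b \<longleftrightarrow> norm (y - x - t *\<^sub>R a - t\<^sup>2 *\<^sub>R b) \<le> C * t ^ 3 \<and>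
     norm a \<le> C \<and> norm b \<le> C"

lemma second_order_expansion_dist:
  assumes "second_order_expansion C x t y a b" "0 \<le> t" "t \<le> 1" "0 \<le> C"
  shows "norm (y - x) \<le> 3 * C * t" "norm (y - x - t *\<^sub>R a) \<le> 2 * C * t\<^sup>2"
proof -
  have n: "norm (y - x - t *\<^sub>R a - t\<^sup>2 *\<^sub>R b) \<le> C * t ^ 3" "norm a \<le> C" "norm b \<le> C"
    using assms by (auto simp: second_order_expansion_def)
  have t: "t\<^sup>2 \<le> t" "t ^ 3 \<le> t\<^sup>2"
    using assms power_decreasing[of 1 2 t] power_decreasing[of 2 3 t] by auto
  have a: "norm (t *\<^sub>R a) \<le> C * t" using mult_left_mono[OF n(2) assms(2)] assms(2) by (simp add: mult.commute)
  have b: "norm (t\<^sup>2 *\<^sub>R b) \<le> C * t\<^sup>2" using mult_left_mono[OF n(3), of "t\<^sup>2"] by (simp add: mult.commute)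
  have 3: "C * t ^ 3 \<le> C * t\<^sup>2" "C * t\<^sup>2 \<le> C * t" using t assms by (auto intro: mult_left_mono)
  have "norm (y - x - t *\<^sub>R a) \<le> norm (y - x - t *\<^sub>R a - t\<^sup>2 *\<^sub>R b) + norm (t\<^sup>2 *\<^sub>R b)"
    by (metis diff_add_cancel norm_triangle_ineq)
  then show *: "norm (y - x - t *\<^sub>R a) \<le> 2 * C * t\<^sup>2" using n b 3 by linarith
  have "norm (y - x) \<le> norm (y - x - t *\<^sub>R a) + norm (t *\<^sub>R a)"
    by (metis diff_add_cancel norm_triangle_ineq)
  then show "norm (y - x) \<le> 3 * C * t" using * a 3 by linarith
qed

text \<open>
  Appending the second-order step of \<open>f\<close> in the time direction \<open>\<sigma> = \<plusminus>1\<close> to an expansion: the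
  coefficients change by Taylor expansion of \<open>f\<close> at the base point \<open>x\<close>. The new
  constant is independent of \<open>x\<close> and \<open>t\<close>.
\<close>

lemma second_order_expansion_step:
  fixes f :: "'e::real_normed_vector \<Rightarrow> 'e"
  assumes f: "C11_on B f f' K" and xy: "x \<in> B" "y \<in> B" and t: "0 \<le> t" "t \<le> 1"
    and C: "0 \<le> C" "0 \<le> D" and exp: "second_order_expansion C x t y a b" and \<sigma>: "\<sigma>\<^sup>2 = 1"
    and z: "norm (z - y - (\<sigma> * t) *\<^sub>R f y - ((\<sigma> * t)\<^sup>2 / 2) *\<^sub>R f' y (f y)) \<le> D * \<bar>\<sigma> * t\<bar> ^ 3"
  shows "second_order_expansion (C + D + K * (3 * C)\<^sup>2 + K * (3 * C) + 3 * K * K * C + K + K * K)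
    x t z (a + \<sigma> *\<^sub>R f x) (b + \<sigma> *\<^sub>R f' x a + (1/2) *\<^sub>R f' x (f x))"
proof -
  note fx = C11_onD[OF f xy(1)] and fy = C11_onD[OF f xy(2)] and fxy = C11_onD2[OF f xy]
  note K = fx(1)
  interpret f': bounded_linear "f' x" by (rule fx(2))
  interpret fy': bounded_linear "f' y" by (rule fy(2))
  have e: "norm (y - x - t *\<^sub>R a - t\<^sup>2 *\<^sub>R b) \<le> C * t ^ 3" "norm a \<le> C" "norm b \<le> C"
    using exp by (auto simp: second_order_expansion_def)
  note d = second_order_expansion_dist[OF exp t C(1)]
  have s1: "\<bar>\<sigma>\<bar> = 1" using \<sigma> by (metis abs_1 abs_square_eq_1)
  have z': "norm (z - y - (\<sigma> * t) *\<^sub>R f y - (t\<^sup>2 / 2) *\<^sub>R f' y (f y)) \<le> D * t ^ 3"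
    using z \<sigma> s1 t by (simp add: power_mult_distrib abs_mult)
  have a1: "norm ((\<sigma> * t) *\<^sub>R (f y - f x - f' x (y - x))) \<le> K * (3 * C)\<^sup>2 * t ^ 3"
  proof -
    have "norm ((\<sigma> * t) *\<^sub>R (f y - f x - f' x (y - x))) \<le> t * (K * (norm (y - x))\<^sup>2)"
      using fxy(2) t s1 by (simp add: abs_mult mult_left_mono)
    also have "\<dots> \<le> t * (K * (3 * C * t)\<^sup>2)"
      using d(1) K t by (intro mult_left_mono power_mono) auto
    finally show ?thesis by (simp add: power2_eq_square power3_eq_cube ac_simps)
  qed
  have a2: "norm ((\<sigma> * t) *\<^sub>R f' x (y - x - t *\<^sub>R a)) \<le> K * (2 * C) * t ^ 3"
  proof -
    have "norm ((\<sigma> * t) *\<^sub>R f' x (y - x - t *\<^sub>R a)) \<le> t * (K * norm (y - x - t *\<^sub>R a))"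
      using fx(4) t s1 by (simp add: abs_mult mult_left_mono)
    also have "\<dots> \<le> t * (K * (2 * C * t\<^sup>2))"
      using d(2) K t by (intro mult_left_mono) auto
    finally show ?thesis by (simp add: power2_eq_square power3_eq_cube ac_simps)
  qed
  have a3: "norm ((t\<^sup>2 / 2) *\<^sub>R (f' y (f y) - f' x (f x))) \<le> 3 * K * K * C * t ^ 3"
  proof -
    have "norm (f' y (f y) - f' x (f x)) = norm (f' y (f y - f x) + (f' y (f x) - f' x (f x)))"
      by (simp add: fy'.diff)
    also have "\<dots> \<le> norm (f' y (f y - f x)) + norm (f' y (f x) - f' x (f x))"
      by (rule norm_triangle_ineq)
    also have "\<dots> \<le> K * (K * norm (y - x)) + K * norm (y - x) * K"
    proof (rule add_mono)
      show "norm (f' y (f y - f x)) \<le> K * (K * norm (y - x))"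
        using order_trans[OF fy(4)[of "f y - f x"] mult_left_mono[OF fxy(1) K]] .
      have "K * norm (y - x) * norm (f x) \<le> K * norm (y - x) * K"
        using fx(3) K by (intro mult_left_mono) auto
      then show "norm (f' y (f x) - f' x (f x)) \<le> K * norm (y - x) * K"
        using fxy(3)[of "f x"] by linarith
    qed
    also have "\<dots> = 2 * (K * K) * norm (y - x)" by simp
    also have "\<dots> \<le> 2 * (K * K) * (3 * C * t)" using d(1) K by (intro mult_left_mono) auto
    finally have "(t\<^sup>2 / 2) * norm (f' y (f y) - f' x (f x)) \<le> (t\<^sup>2 / 2) * (2 * (K * K) * (3 * C * t))"
      by (intro mult_left_mono) auto
    then show ?thesis by (simp add: power2_eq_square power3_eq_cube ac_simps)
  qed
  have e1: "(\<sigma> * t) *\<^sub>R f' x (y - x - t *\<^sub>R a) = (\<sigma> * t) *\<^sub>R f' x (y - x) - (\<sigma> * t\<^sup>2) *\<^sub>R f' x a"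
    by (simp add: f'.diff f'.scaleR scaleR_diff_right power2_eq_square mult.assoc)
  have e2: "t\<^sup>2 *\<^sub>R (b + \<sigma> *\<^sub>R f' x a + (1/2) *\<^sub>R f' x (f x))
      = t\<^sup>2 *\<^sub>R b + (\<sigma> * t\<^sup>2) *\<^sub>R f' x a + (t\<^sup>2 / 2) *\<^sub>R f' x (f x)"
    by (simp add: scaleR_add_right mult.commute)
  have "norm (z - x - t *\<^sub>R (a + \<sigma> *\<^sub>R f x) - t\<^sup>2 *\<^sub>R (b + \<sigma> *\<^sub>R f' x a + (1/2) *\<^sub>R f' x (f x)))
     = norm ((y - x - t *\<^sub>R a - t\<^sup>2 *\<^sub>R b) + (z - y - (\<sigma> * t) *\<^sub>R f y - (t\<^sup>2 / 2) *\<^sub>R f' y (f y))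
         + (\<sigma> * t) *\<^sub>R (f y - f x - f' x (y - x)) + (\<sigma> * t) *\<^sub>R f' x (y - x - t *\<^sub>R a)
         + (t\<^sup>2 / 2) *\<^sub>R (f' y (f y) - f' x (f x)))"
    unfolding e1 e2 by (simp add: algebra_simps)
  also have "\<dots> \<le> C * t ^ 3 + D * t ^ 3 + K * (3 * C)\<^sup>2 * t ^ 3 + K * (2 * C) * t ^ 3 + 3 * K * K * C * t ^ 3"
    by (rule norm_add_le5[OF e(1) z' a1 a2 a3])
  also have "\<dots> = (C + D + K * (3 * C)\<^sup>2 + K * (2 * C) + 3 * K * K * C) * t ^ 3"
    by (simp add: algebra_simps)
  also have "\<dots> \<le> (C + D + K * (3 * C)\<^sup>2 + K * (3 * C) + 3 * K * K * C + K + K * K) * t ^ 3"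
    using t K C by (intro mult_right_mono) auto
  finally have 1: "norm (z - x - t *\<^sub>R (a + \<sigma> *\<^sub>R f x) - t\<^sup>2 *\<^sub>R (b + \<sigma> *\<^sub>R f' x a + (1/2) *\<^sub>R f' x (f x)))
    \<le> (C + D + K * (3 * C)\<^sup>2 + K * (3 * C) + 3 * K * K * C + K + K * K) * t ^ 3" .
  have nn: "0 \<le> K * (3 * C)\<^sup>2" "0 \<le> K * C" "0 \<le> 3 * K * K * C" "0 \<le> K * K"
    using K C by auto
  have "norm (a + \<sigma> *\<^sub>R f x) \<le> C + K"
    using norm_triangle_ineq[of a "\<sigma> *\<^sub>R f x"] e fx(3) s1 by simp
  then have 2: "norm (a + \<sigma> *\<^sub>R f x) \<le> C + D + K * (3 * C)\<^sup>2 + K * (3 * C) + 3 * K * K * C + K + K * K"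
    using nn C by linarith
  have "norm (f' x a) \<le> K * C" "norm (f' x (f x)) \<le> K * K"
    using order_trans[OF fx(4)[of a] mult_left_mono[OF e(2) K]]
      order_trans[OF fx(4)[of "f x"] mult_left_mono[OF fx(3) K]] by auto
  then have "norm (b + \<sigma> *\<^sub>R f' x a + (1/2) *\<^sub>R f' x (f x) + 0) \<le> C + K * C + K * K + 0"
    using e(3) s1 zero_le_square[of K] by (intro norm_add_le4) (simp_all del: zero_le_square)
  then have "norm (b + \<sigma> *\<^sub>R f' x a + (1/2) *\<^sub>R f' x (f x)) \<le> C + K * C + K * K" by simp
  then have "norm (b + \<sigma> *\<^sub>R f' x a + (1/2) *\<^sub>R f' x (f x))
      \<le> C + D + K * (3 * C)\<^sup>2 + K * (3 * C) + 3 * K * K * C + K + K * K"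
    using nn C K by linarith
  with 1 2 show ?thesis by (simp add: second_order_expansion_def)
qed

section \<open>Lie brackets of tangent fields are tangent\<close>

text \<open>
  The commutator of flows: the steps \<open>f, g, -f, -g\<close>, each over the time \<open>t = \<surd>h\<close>, compose to
  \<open>x + t\<^sup>2 (g' f - f' g) + O(t\<^sup>3)\<close>, and all intermediate points lie in \<open>S\<close>. Since \<open>O(t\<^sup>3) = o(h)\<close>, the
  bracket is tangent in forward time.
\<close>

lemma bracket_one_sided:
  fixes f :: "'e::real_normed_vector \<Rightarrow> 'e"
  assumes f: "C11_on (ball p r) f f' K" and g: "C11_on (ball p r) g g' K"
    and tanf: "uniformly_tangent S f (ball p r)" and tang: "uniformly_tangent S g (ball p r)"
    and r: "0 < r" and \<epsilon>: "0 < \<epsilon>"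
  shows "\<exists>\<delta>>0. \<forall>x\<in>S \<inter> ball p (r/4). \<forall>h. 0 \<le> h \<longrightarrow> h \<le> \<delta> \<longrightarrow>
    (\<exists>y\<in>S. norm (y - x - h *\<^sub>R (g' x (f x) - f' x (g x))) \<le> \<epsilon> * h)"
proof -
  obtain Cf \<delta>f where Cf: "0 < \<delta>f" "0 \<le> Cf" and stepf: "\<And>x h. x \<in> S \<Longrightarrow> x \<in> ball p (r/2) \<Longrightarrow> \<bar>h\<bar> \<le> \<delta>f \<Longrightarrow>
       \<exists>y\<in>S. norm (y - x - h *\<^sub>R f x - (h\<^sup>2 / 2) *\<^sub>R f' x (f x)) \<le> Cf * \<bar>h\<bar> ^ 3"
    by (rule second_order_tangent_step[OF f tanf r]) (rule that)
  obtain Cg \<delta>g where Cg: "0 < \<delta>g" "0 \<le> Cg" and stepg: "\<And>x h. x \<in> S \<Longrightarrow> x \<in> ball p (r/2) \<Longrightarrow> \<bar>h\<bar> \<le> \<delta>g \<Longrightarrow>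
       \<exists>y\<in>S. norm (y - x - h *\<^sub>R g x - (h\<^sup>2 / 2) *\<^sub>R g' x (g x)) \<le> Cg * \<bar>h\<bar> ^ 3"
    by (rule second_order_tangent_step[OF g tang r]) (rule that)
  define D where "D = max Cf Cg"
  have D: "0 \<le> D" using Cf by (simp add: D_def)
  have K: "0 \<le> K" using f by (simp add: C11_on_def)
  \<comment> \<open>\<open>G\<close> is the effect of one step on the constant of an expansion; four steps are made.\<close>
  define G where "G C = C + D + K * (3 * C)\<^sup>2 + K * (3 * C) + 3 * K * K * C + K + K * K" for C
  have G: "C \<le> G C" if "0 \<le> C" for C
    using K D that mult_nonneg_nonneg[of K C] mult_nonneg_nonneg[of K K]
      mult_nonneg_nonneg[of "K * K" C] mult_nonneg_nonneg[of K "(3 * C)\<^sup>2"]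
    unfolding G_def by simp
  define M where "M = G (G (G (G 0)))"
  have G0: "0 \<le> G 0" using G by simp
  have G1: "G 0 \<le> G (G 0)" using G[OF G0] .
  have G2: "G (G 0) \<le> G (G (G 0))" using G[of "G (G 0)"] G0 G1 by linarith
  have G3: "G (G (G 0)) \<le> M" using G[of "G (G (G 0))"] G0 G1 G2 unfolding M_def by linarith
  have M: "0 \<le> M" using G0 G1 G2 G3 by linarith
  define t0 where "t0 = min (min 1 (min \<delta>f \<delta>g)) (min (r / (12 * (M + 1))) (\<epsilon> / (M + 1)))"
  have t0: "0 < t0" using Cf Cg r \<epsilon> M by (simp add: t0_def)
  have "\<exists>z\<in>S. norm (z - x - h *\<^sub>R (g' x (f x) - f' x (g x))) \<le> \<epsilon> * h"
    if x: "x \<in> S" "x \<in> ball p (r/4)" and h: "0 \<le> h" "h \<le> t0\<^sup>2" for x h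
  proof -
    define t where "t = sqrt h"
    have t: "0 \<le> t" "t\<^sup>2 = h" using h by (auto simp: t_def)
    have tt0: "t \<le> t0" using h t0 by (simp add: t_def real_le_lsqrt)
    have t1: "t \<le> 1" "t \<le> \<delta>f" "t \<le> \<delta>g" and "t \<le> r / (12 * (M + 1))" "t \<le> \<epsilon> / (M + 1)"
      using tt0 by (auto simp: t0_def)
    then have "12 * (M + 1) * t \<le> r" and "(M + 1) * t \<le> \<epsilon>"
      using M by (auto simp: pos_le_divide_eq mult.commute)
    then have Mr: "12 * M * t \<le> r" and M\<epsilon>: "M * t \<le> \<epsilon>"
      using t(1) by (auto simp: algebra_simps)
    have xr: "x \<in> ball p r" using x(2) r by auto
    have near: "y \<in> ball p (r/2)" "y \<in> ball p r"
      if "second_order_expansion C x t y a b" "0 \<le> C" "C \<le> M" for C y a b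
    proof -
      have "norm (y - x) \<le> 3 * C * t"
        by (rule second_order_expansion_dist(1)[OF that(1) t(1) t1(1) that(2)])
      also have "\<dots> \<le> 3 * M * t" using that t(1) by (intro mult_right_mono) auto
      finally have "norm (y - x) \<le> r / 4" using Mr by linarith
      moreover have "dist p y \<le> dist p x + norm (y - x)"
        by (metis dist_commute dist_norm dist_triangle)
      ultimately show "y \<in> ball p (r/2)" "y \<in> ball p r" using x(2) r by auto
    qed
    have advf: "\<exists>z\<in>S. second_order_expansion (G C) x t z
        (a + \<sigma> *\<^sub>R f x) (b + \<sigma> *\<^sub>R f' x a + (1/2) *\<^sub>R f' x (f x))"
      if e: "second_order_expansion C x t y a b" "0 \<le> C" "C \<le> M" "y \<in> S" "\<sigma>\<^sup>2 = 1" for C y a b \<sigma>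
    proof -
      have s: "\<bar>\<sigma> * t\<bar> = t" using e(5) t(1) by (metis abs_1 abs_mult abs_of_nonneg abs_square_eq_1 mult_1)
      obtain z where z: "z \<in> S" "norm (z - y - (\<sigma> * t) *\<^sub>R f y - ((\<sigma> * t)\<^sup>2 / 2) *\<^sub>R f' y (f y)) \<le> Cf * \<bar>\<sigma> * t\<bar> ^ 3"
        using stepf[OF e(4) near(1)[OF e(1-3)], of "\<sigma> * t"] s t1 by auto
      have "Cf * \<bar>\<sigma> * t\<bar> ^ 3 \<le> D * \<bar>\<sigma> * t\<bar> ^ 3" by (intro mult_right_mono) (auto simp: D_def)
      from second_order_expansion_step[OF f xr near(2)[OF e(1-3)] t(1) t1(1) e(2) D e(1,5) order_trans[OF z(2) this]]
      show ?thesis using z(1) unfolding G_def by blast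
    qed
    have advg: "\<exists>z\<in>S. second_order_expansion (G C) x t z
        (a + \<sigma> *\<^sub>R g x) (b + \<sigma> *\<^sub>R g' x a + (1/2) *\<^sub>R g' x (g x))"
      if e: "second_order_expansion C x t y a b" "0 \<le> C" "C \<le> M" "y \<in> S" "\<sigma>\<^sup>2 = 1" for C y a b \<sigma>
    proof -
      have s: "\<bar>\<sigma> * t\<bar> = t" using e(5) t(1) by (metis abs_1 abs_mult abs_of_nonneg abs_square_eq_1 mult_1)
      obtain z where z: "z \<in> S" "norm (z - y - (\<sigma> * t) *\<^sub>R g y - ((\<sigma> * t)\<^sup>2 / 2) *\<^sub>R g' y (g y)) \<le> Cg * \<bar>\<sigma> * t\<bar> ^ 3"
        using stepg[OF e(4) near(1)[OF e(1-3)], of "\<sigma> * t"] s t1 by auto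
      have "Cg * \<bar>\<sigma> * t\<bar> ^ 3 \<le> D * \<bar>\<sigma> * t\<bar> ^ 3" by (intro mult_right_mono) (auto simp: D_def)
      from second_order_expansion_step[OF g xr near(2)[OF e(1-3)] t(1) t1(1) e(2) D e(1,5) order_trans[OF z(2) this]]
      show ?thesis using z(1) unfolding G_def by blast
    qed
    interpret f': bounded_linear "f' x" using C11_onD(2)[OF f xr] .
    interpret g': bounded_linear "g' x" using C11_onD(2)[OF g xr] .
    have "second_order_expansion 0 x t x 0 0" by (simp add: second_order_expansion_def)
    from advf[OF this _ M x(1), of 1] obtain y1 where y1: "y1 \<in> S"
      and e1: "second_order_expansion (G 0) x t y1 (f x) ((1/2) *\<^sub>R f' x (f x))"
      by (auto simp: f'.zero)
    have b1: "0 \<le> G 0" "G 0 \<le> M" "0 \<le> G (G 0)" "G (G 0) \<le> M" "0 \<le> G (G (G 0))"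
      using G0 G1 G2 G3 by linarith+
    from advg[OF e1 b1(1,2) y1, of 1] obtain y2 where y2: "y2 \<in> S"
      and e2: "second_order_expansion (G (G 0)) x t y2 (f x + g x)
        ((1/2) *\<^sub>R f' x (f x) + g' x (f x) + (1/2) *\<^sub>R g' x (g x))"
      by auto
    from advf[OF e2 b1(3,4) y2, of "-1"] obtain y3 where y3: "y3 \<in> S"
      and e3: "second_order_expansion (G (G (G 0))) x t y3 (f x + g x + (-1) *\<^sub>R f x)
        ((1/2) *\<^sub>R f' x (f x) + g' x (f x) + (1/2) *\<^sub>R g' x (g x) + (-1) *\<^sub>R f' x (f x + g x)
          + (1/2) *\<^sub>R f' x (f x))"
      by auto
    from advg[OF e3 b1(5) G3 y3, of "-1"] obtain y4 where y4: "y4 \<in> S"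
      and e4: "second_order_expansion M x t y4 (f x + g x + (-1) *\<^sub>R f x + (-1) *\<^sub>R g x)
        ((1/2) *\<^sub>R f' x (f x) + g' x (f x) + (1/2) *\<^sub>R g' x (g x) + (-1) *\<^sub>R f' x (f x + g x)
          + (1/2) *\<^sub>R f' x (f x) + (-1) *\<^sub>R g' x (f x + g x + (-1) *\<^sub>R f x) + (1/2) *\<^sub>R g' x (g x))"
      unfolding M_def by auto
    \<comment> \<open>All pure terms of second order cancel; the two mixed ones form the bracket.\<close>
    have halves: "(1/2) *\<^sub>R v + w + (1/2) *\<^sub>R u + (- 1) *\<^sub>R (v + z) + (1/2) *\<^sub>R v + (- 1) *\<^sub>R u + (1/2) *\<^sub>R u = w - z"
      for u v w z :: 'e
      by (simp add: algebra_simps flip: scaleR_add_left)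
    have eqb: "((1/2) *\<^sub>R f' x (f x) + g' x (f x) + (1/2) *\<^sub>R g' x (g x) + (-1) *\<^sub>R f' x (f x + g x)
          + (1/2) *\<^sub>R f' x (f x) + (-1) *\<^sub>R g' x (f x + g x + (-1) *\<^sub>R f x) + (1/2) *\<^sub>R g' x (g x))
        = g' x (f x) - f' x (g x)"
      using halves[of "f' x (f x)" "g' x (f x)" "g' x (g x)" "f' x (g x)"] by (simp add: f'.add)
    have "second_order_expansion M x t y4 0 (g' x (f x) - f' x (g x))"
      using e4 unfolding eqb by simp
    then have "norm (y4 - x - h *\<^sub>R (g' x (f x) - f' x (g x))) \<le> M * t ^ 3"
      by (simp add: second_order_expansion_def t)
    also have "M * t ^ 3 = (M * t) * h" unfolding t(2)[symmetric] by (simp add: power2_eq_square power3_eq_cube)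
    also have "\<dots> \<le> \<epsilon> * h" using M\<epsilon> h by (intro mult_right_mono)
    finally show ?thesis using y4 by blast
  qed
  then show ?thesis using t0 by (intro exI[of _ "t0\<^sup>2"]) auto
qed

text \<open>
  Backward time for the bracket of \<open>f\<close> and \<open>g\<close> is forward time for the bracket of \<open>g\<close> and \<open>f\<close>.
\<close>

lemma uniformly_tangent_bracket:
  fixes f :: "'e::real_normed_vector \<Rightarrow> 'e"
  assumes f: "C11_on (ball p r) f f' K" and g: "C11_on (ball p r) g g' K"
    and tanf: "uniformly_tangent S f (ball p r)" and tang: "uniformly_tangent S g (ball p r)"
    and r: "0 < r"
  shows "uniformly_tangent S (\<lambda>x. g' x (f x) - f' x (g x)) (ball p (r/4))"
  unfolding uniformly_tangent_def
proof (intro allI impI)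
  fix \<epsilon> :: real assume \<epsilon>: "0 < \<epsilon>"
  obtain \<delta>1 where 1: "0 < \<delta>1" "\<forall>x\<in>S \<inter> ball p (r/4). \<forall>h. 0 \<le> h \<longrightarrow> h \<le> \<delta>1 \<longrightarrow>
    (\<exists>y\<in>S. norm (y - x - h *\<^sub>R (g' x (f x) - f' x (g x))) \<le> \<epsilon> * h)"
    using bracket_one_sided[OF f g tanf tang r \<epsilon>] by blast
  obtain \<delta>2 where 2: "0 < \<delta>2" "\<forall>x\<in>S \<inter> ball p (r/4). \<forall>h. 0 \<le> h \<longrightarrow> h \<le> \<delta>2 \<longrightarrow>
    (\<exists>y\<in>S. norm (y - x - h *\<^sub>R (f' x (g x) - g' x (f x))) \<le> \<epsilon> * h)"
    using bracket_one_sided[OF g f tang tanf r \<epsilon>] by blast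
  have "\<exists>y\<in>S. norm (y - x - h *\<^sub>R (g' x (f x) - f' x (g x))) \<le> \<epsilon> * \<bar>h\<bar>"
    if x: "x \<in> S \<inter> ball p (r/4)" and h: "\<bar>h\<bar> \<le> min \<delta>1 \<delta>2" for x h
  proof (cases "0 \<le> h")
    case True
    then show ?thesis using 1(2) x h by auto
  next
    case False
    then obtain y where y: "y \<in> S" "norm (y - x - (-h) *\<^sub>R (f' x (g x) - g' x (f x))) \<le> \<epsilon> * (-h)"
      using 2(2)[rule_format, of x "-h"] x h by auto
    have "(-h) *\<^sub>R (f' x (g x) - g' x (f x)) = h *\<^sub>R (g' x (f x) - f' x (g x))"
      by (simp add: algebra_simps)
    with y False show ?thesis by (intro bexI[of _ y]) (simp_all only: abs_of_neg not_le mult_minus_right)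
  qed
  then show "\<exists>\<delta>>0. \<forall>x\<in>S \<inter> ball p (r/4). \<forall>h. \<bar>h\<bar> \<le> \<delta> \<longrightarrow>
      (\<exists>y\<in>S. norm (y - x - h *\<^sub>R (g' x (f x) - f' x (g x))) \<le> \<epsilon> * \<bar>h\<bar>)"
    using 1 2 by (intro exI[of _ "min \<delta>1 \<delta>2"]) auto
qed

section \<open>Linear combinations of tangent fields\<close>

text \<open>
  Linear combinations stay tangent if the fields are also Lipschitz near the point: after a step along
  \<open>f\<close> the second field has changed by \<open>O(h)\<close> only.
\<close>

definition lipschitz_tangent :: "'e::real_normed_vector set \<Rightarrow> ('e \<Rightarrow> 'e) \<Rightarrow> 'e \<Rightarrow> bool" where
  "lipschitz_tangent S f p \<longleftrightarrow> (\<exists>r>0. \<exists>K\<ge>0. (\<forall>x\<in>ball p r. norm (f x) \<le> K) \<and>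
     (\<forall>x\<in>ball p r. \<forall>y\<in>ball p r. norm (f y - f x) \<le> K * norm (y - x)) \<and>
     uniformly_tangent S f (ball p r))"

lemma lipschitz_tangentD:
  assumes "lipschitz_tangent S f p"
  obtains r K where "0 < r" "0 \<le> K" "\<And>x. x \<in> ball p r \<Longrightarrow> norm (f x) \<le> K"
    "\<And>x y. x \<in> ball p r \<Longrightarrow> y \<in> ball p r \<Longrightarrow> norm (f y - f x) \<le> K * norm (y - x)"
    "uniformly_tangent S f (ball p r)"
  using assms unfolding lipschitz_tangent_def by blast

lemma uniformly_tangent_scaleR:
  assumes "uniformly_tangent S f B"
  shows "uniformly_tangent S (\<lambda>x. c *\<^sub>R f x) B"
proof (rule uniformly_tangentI)
  fix \<epsilon> :: real assume \<epsilon>: "0 < \<epsilon>"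
  have c: "0 < \<bar>c\<bar> + 1" by simp
  have "0 < \<epsilon> / (\<bar>c\<bar> + 1)" using \<epsilon> c by simp
  then obtain \<delta> where \<delta>: "0 < \<delta>" "\<And>x h. x \<in> S \<Longrightarrow> x \<in> B \<Longrightarrow> \<bar>h\<bar> \<le> \<delta> \<Longrightarrow>
      \<exists>y\<in>S. norm (y - x - h *\<^sub>R f x) \<le> \<epsilon> / (\<bar>c\<bar> + 1) * \<bar>h\<bar>"
    using uniformly_tangentD[OF assms] by blast
  have "\<exists>y\<in>S. norm (y - x - h *\<^sub>R c *\<^sub>R f x) \<le> \<epsilon> * \<bar>h\<bar>"
    if x: "x \<in> S" "x \<in> B" and h: "\<bar>h\<bar> \<le> \<delta> / (\<bar>c\<bar> + 1)" for x h
  proof -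
    have "\<bar>h\<bar> * (\<bar>c\<bar> + 1) \<le> \<delta>" using h c by (simp add: pos_le_divide_eq)
    then have "\<bar>h * c\<bar> \<le> \<delta>" by (simp add: abs_mult algebra_simps)
    then obtain y where y: "y \<in> S" "norm (y - x - (h * c) *\<^sub>R f x) \<le> \<epsilon> / (\<bar>c\<bar> + 1) * \<bar>h * c\<bar>"
      using \<delta>(2)[OF x] by blast
    have "\<epsilon> / (\<bar>c\<bar> + 1) * \<bar>h * c\<bar> = (\<epsilon> * \<bar>h\<bar>) * (\<bar>c\<bar> / (\<bar>c\<bar> + 1))" by (simp add: abs_mult)
    also have "\<dots> \<le> (\<epsilon> * \<bar>h\<bar>) * 1" using \<epsilon> by (intro mult_left_mono) auto
    finally have "norm (y - x - h *\<^sub>R c *\<^sub>R f x) \<le> \<epsilon> * \<bar>h\<bar>"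
      using order_trans[OF y(2)] by simp
    with y(1) show ?thesis by blast
  qed
  then show "\<exists>\<delta>>0. \<forall>x h. x \<in> S \<longrightarrow> x \<in> B \<longrightarrow> \<bar>h\<bar> \<le> \<delta> \<longrightarrow>
      (\<exists>y\<in>S. norm (y - x - h *\<^sub>R c *\<^sub>R f x) \<le> \<epsilon> * \<bar>h\<bar>)"
    using \<delta>(1) c by (intro exI[of _ "\<delta> / (\<bar>c\<bar> + 1)"]) auto
qed

lemma lipschitz_tangent_scaleR:
  assumes "lipschitz_tangent S f p"
  shows "lipschitz_tangent S (\<lambda>x. c *\<^sub>R f x) p"
proof -
  obtain r K where rK: "0 < r" "0 \<le> K" "\<And>x. x \<in> ball p r \<Longrightarrow> norm (f x) \<le> K"
    "\<And>x y. x \<in> ball p r \<Longrightarrow> y \<in> ball p r \<Longrightarrow> norm (f y - f x) \<le> K * norm (y - x)"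
    "uniformly_tangent S f (ball p r)"
    using lipschitz_tangentD[OF assms] by blast
  show ?thesis
    unfolding lipschitz_tangent_def
  proof (rule exI[of _ r], intro conjI exI[of _ "\<bar>c\<bar> * K"] ballI)
    show "uniformly_tangent S (\<lambda>x. c *\<^sub>R f x) (ball p r)"
      using uniformly_tangent_scaleR[OF rK(5)] .
    show "norm (c *\<^sub>R f x) \<le> \<bar>c\<bar> * K" if "x \<in> ball p r" for x
      using rK(3)[OF that] by (simp add: mult_left_mono)
    show "norm (c *\<^sub>R f y - c *\<^sub>R f x) \<le> \<bar>c\<bar> * K * norm (y - x)"
      if "x \<in> ball p r" "y \<in> ball p r" for x y
      using mult_left_mono[OF rK(4)[OF that], of "\<bar>c\<bar>"]
      by (simp add: mult.assoc flip: scaleR_diff_right)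
  qed (use rK in auto)
qed

lemma lipschitz_tangent_zero: "lipschitz_tangent S (\<lambda>x. 0) p"
  unfolding lipschitz_tangent_def
proof (rule exI[of _ 1], intro conjI exI[of _ 0] ballI; (rule uniformly_tangentI)?)
  show "\<exists>\<delta>>0. \<forall>x h. x \<in> S \<longrightarrow> x \<in> ball p 1 \<longrightarrow> \<bar>h\<bar> \<le> \<delta> \<longrightarrow>
      (\<exists>y\<in>S. norm (y - x - h *\<^sub>R 0) \<le> \<epsilon> * \<bar>h\<bar>)" if "0 < \<epsilon>" for \<epsilon> :: real
    using that by (intro exI[of _ 1] conjI allI impI) (auto intro!: bexI)
qed auto

lemma lipschitz_tangent_add:
  fixes f g :: "'e::real_normed_vector \<Rightarrow> 'e"
  assumes "lipschitz_tangent S f p" "lipschitz_tangent S g p"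
  shows "lipschitz_tangent S (\<lambda>x. f x + g x) p"
proof -
  obtain rf Kf where f: "0 < rf" "0 \<le> Kf" "\<And>x. x \<in> ball p rf \<Longrightarrow> norm (f x) \<le> Kf"
    "\<And>x y. x \<in> ball p rf \<Longrightarrow> y \<in> ball p rf \<Longrightarrow> norm (f y - f x) \<le> Kf * norm (y - x)"
    "uniformly_tangent S f (ball p rf)"
    using lipschitz_tangentD[OF assms(1)] by blast
  obtain rg Kg where g: "0 < rg" "0 \<le> Kg" "\<And>x. x \<in> ball p rg \<Longrightarrow> norm (g x) \<le> Kg"
    "\<And>x y. x \<in> ball p rg \<Longrightarrow> y \<in> ball p rg \<Longrightarrow> norm (g y - g x) \<le> Kg * norm (y - x)"
    "uniformly_tangent S g (ball p rg)"
    using lipschitz_tangentD[OF assms(2)] by blast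
  define r where "r = min rf rg"
  have r: "0 < r" "r \<le> rf" "r \<le> rg" using f g by (auto simp: r_def)
  have tan: "uniformly_tangent S (\<lambda>x. f x + g x) (ball p (r/2))"
  proof (rule uniformly_tangentI)
    fix \<epsilon> :: real assume \<epsilon>: "0 < \<epsilon>"
    define \<epsilon>' where "\<epsilon>' = min 1 (\<epsilon> / 3)"
    have \<epsilon>': "0 < \<epsilon>'" "\<epsilon>' \<le> 1" "3 * \<epsilon>' \<le> \<epsilon>" using \<epsilon> by (auto simp: \<epsilon>'_def)
    obtain \<delta>1 where 1: "0 < \<delta>1" "\<And>x h. x \<in> S \<Longrightarrow> x \<in> ball p rf \<Longrightarrow> \<bar>h\<bar> \<le> \<delta>1 \<Longrightarrow>
        \<exists>y\<in>S. norm (y - x - h *\<^sub>R f x) \<le> \<epsilon>' * \<bar>h\<bar>"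
      using uniformly_tangentD[OF f(5) \<epsilon>'(1)] by blast
    obtain \<delta>2 where 2: "0 < \<delta>2" "\<And>x h. x \<in> S \<Longrightarrow> x \<in> ball p rg \<Longrightarrow> \<bar>h\<bar> \<le> \<delta>2 \<Longrightarrow>
        \<exists>y\<in>S. norm (y - x - h *\<^sub>R g x) \<le> \<epsilon>' * \<bar>h\<bar>"
      using uniformly_tangentD[OF g(5) \<epsilon>'(1)] by blast
    define d where "d = min (min \<delta>1 \<delta>2) (min (r / (2 * (Kf + 1))) (\<epsilon>' / ((Kg + 1) * (Kf + 1))))"
    have d: "0 < d" using 1 2 r f(2) g(2) \<epsilon>' by (simp add: d_def)
    have "\<exists>z\<in>S. norm (z - x - h *\<^sub>R (f x + g x)) \<le> \<epsilon> * \<bar>h\<bar>"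
      if x: "x \<in> S" "x \<in> ball p (r/2)" and h: "\<bar>h\<bar> \<le> d" for x h
    proof -
      have h1: "\<bar>h\<bar> \<le> \<delta>1" "\<bar>h\<bar> \<le> \<delta>2" "\<bar>h\<bar> \<le> r / (2 * (Kf + 1))" "\<bar>h\<bar> \<le> \<epsilon>' / ((Kg + 1) * (Kf + 1))"
        using h by (auto simp: d_def)
      have pos: "0 < 2 * (Kf + 1)" "0 < (Kg + 1) * (Kf + 1)" using f(2) g(2) by auto
      have h2: "\<bar>h\<bar> * (2 * (Kf + 1)) \<le> r" "\<bar>h\<bar> * ((Kg + 1) * (Kf + 1)) \<le> \<epsilon>'"
        using h1(3,4) by (simp_all only: pos_le_divide_eq[OF pos(1)] pos_le_divide_eq[OF pos(2)])
      have xf: "x \<in> ball p rf" "x \<in> ball p rg" using x r by auto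
      obtain y where y: "y \<in> S" "norm (y - x - h *\<^sub>R f x) \<le> \<epsilon>' * \<bar>h\<bar>"
        using 1(2)[OF x(1) xf(1) h1(1)] by blast
      have "norm (y - x) \<le> norm (y - x - h *\<^sub>R f x) + norm (h *\<^sub>R f x)"
        by (metis diff_add_cancel norm_triangle_ineq)
      also have "\<dots> \<le> 1 * \<bar>h\<bar> + \<bar>h\<bar> * Kf"
        using y(2) \<epsilon>' f(3)[OF xf(1)] mult_right_mono[OF \<epsilon>'(2), of "\<bar>h\<bar>"]
          mult_left_mono[OF f(3)[OF xf(1)], of "\<bar>h\<bar>"] by simp
      finally have yx: "norm (y - x) \<le> \<bar>h\<bar> * (Kf + 1)" by (simp add: algebra_simps)
      have "dist p y \<le> dist p x + norm (y - x)"
        by (metis dist_commute dist_norm dist_triangle)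
      moreover have "2 * norm (y - x) \<le> r" using yx h2(1) by linarith
      ultimately have yg: "y \<in> ball p rg" using x r by auto
      obtain z where z: "z \<in> S" "norm (z - y - h *\<^sub>R g y) \<le> \<epsilon>' * \<bar>h\<bar>"
        using 2(2)[OF y(1) yg h1(2)] by blast
      have "norm (g y - g x) \<le> (Kg + 1) * norm (y - x)"
        using order_trans[OF g(4)[OF xf(2) yg] mult_right_mono[of Kg "Kg + 1" "norm (y - x)"]] by simp
      also have "\<dots> \<le> (Kg + 1) * (\<bar>h\<bar> * (Kf + 1))" using yx g(2) by (intro mult_left_mono) auto
      also have "\<dots> \<le> \<epsilon>'" using h2(2) by (simp add: ac_simps)
      finally have gg: "norm (h *\<^sub>R (g y - g x)) \<le> \<epsilon>' * \<bar>h\<bar>"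
        using mult_left_mono[of "norm (g y - g x)" \<epsilon>' "\<bar>h\<bar>"] by (simp add: mult.commute)
      have "norm (z - x - h *\<^sub>R (f x + g x))
          = norm ((y - x - h *\<^sub>R f x) + (z - y - h *\<^sub>R g y) + h *\<^sub>R (g y - g x) + 0)"
        by (simp add: algebra_simps)
      also have "\<dots> \<le> \<epsilon>' * \<bar>h\<bar> + \<epsilon>' * \<bar>h\<bar> + \<epsilon>' * \<bar>h\<bar> + 0"
        by (rule norm_add_le4) (use y z gg in auto)
      also have "\<dots> = (3 * \<epsilon>') * \<bar>h\<bar>" by simp
      also have "\<dots> \<le> \<epsilon> * \<bar>h\<bar>" using \<epsilon>'(3) by (rule mult_right_mono) simp
      finally show ?thesis using z(1) by blast
    qed
    then show "\<exists>\<delta>>0. \<forall>x h. x \<in> S \<longrightarrow> x \<in> ball p (r/2) \<longrightarrow> \<bar>h\<bar> \<le> \<delta> \<longrightarrow>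
        (\<exists>y\<in>S. norm (y - x - h *\<^sub>R (f x + g x)) \<le> \<epsilon> * \<bar>h\<bar>)"
      using d by (intro exI[of _ d]) auto
  qed
  show ?thesis
    unfolding lipschitz_tangent_def
  proof (rule exI[of _ "r/2"], intro conjI exI[of _ "Kf + Kg"] ballI)
    fix x assume "x \<in> ball p (r/2)"
    then have x: "x \<in> ball p rf" "x \<in> ball p rg" using r by auto
    show "norm (f x + g x) \<le> Kf + Kg"
      using norm_triangle_ineq[of "f x" "g x"] f(3)[OF x(1)] g(3)[OF x(2)] by linarith
    fix y assume "y \<in> ball p (r/2)"
    then have y: "y \<in> ball p rf" "y \<in> ball p rg" using r by auto
    have "norm (f y + g y - (f x + g x)) \<le> norm (f y - f x) + norm (g y - g x)"
      using norm_triangle_ineq[of "f y - f x" "g y - g x"] by (simp add: algebra_simps)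
    then show "norm (f y + g y - (f x + g x)) \<le> (Kf + Kg) * norm (y - x)"
      using f(4)[OF x(1) y(1)] g(4)[OF x(2) y(2)] by (simp add: algebra_simps)
  qed (use r f g tan in auto)
qed

lemma lipschitz_tangent_sum:
  assumes "finite F" "\<And>i. i \<in> F \<Longrightarrow> lipschitz_tangent S (f i) p"
  shows "lipschitz_tangent S (\<lambda>x. \<Sum>i\<in>F. c i *\<^sub>R f i x) p"
  using assms
proof (induction F rule: finite_induct)
  case empty
  then show ?case by (simp add: lipschitz_tangent_zero)
next
  case (insert i F)
  then show ?case
    using lipschitz_tangent_add[OF lipschitz_tangent_scaleR[of S "f i" p "c i"]] by simp
qed

section \<open>Closed sets with full contingent cones\<close>

text \<open>
  Order the points by \<open>y \<preceq> x \<longleftrightarrow> g y + c dist x y \<le> g x\<close>. Descending in this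
  order and almost minimising \<open>g\<close> among the successors at each step produces a Cauchy sequence, and its limit
  has no proper successor.
\<close>

lemma ekeland_variational_principle:
  fixes g :: "'a::metric_space \<Rightarrow> real"
  assumes S: "complete S" and x0: "x0 \<in> S" and g: "continuous_on S g"
    and nonneg: "\<And>x. x \<in> S \<Longrightarrow> 0 \<le> g x" and c: "0 < c"
  obtains s where "s \<in> S" "g s + c * dist x0 s \<le> g x0"
    "\<And>y. y \<in> S \<Longrightarrow> y \<noteq> s \<Longrightarrow> g s < g y + c * dist s y"
proof -
  define F where "F x = {y \<in> S. g y + c * dist x y \<le> g x}" for x
  have F_refl: "x \<in> F x" if "x \<in> S" for x using that by (simp add: F_def)
  have F_trans: "z \<in> F x" if "y \<in> F x" "z \<in> F y" for x y z
  proof -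
    have "c * dist x z \<le> c * dist x y + c * dist y z"
      using c dist_triangle[of x z y] by (metis distrib_left less_imp_le mult_left_mono)
    with that show ?thesis by (auto simp: F_def)
  qed
  have almost_min: "\<exists>y\<in>F x. \<forall>z\<in>F y. g y - g z \<le> e" if x: "x \<in> S" "0 < e" for x e
  proof -
    have ne: "g ` F x \<noteq> {}" using F_refl[OF x(1)] by auto
    have bdd: "bdd_below (g ` F x)" using nonneg by (intro bdd_belowI[of _ 0]) (auto simp: F_def)
    obtain y where y: "y \<in> F x" "g y < Inf (g ` F x) + e"
      using cInf_lessD[OF ne, of "Inf (g ` F x) + e"] x(2) by auto
    have "g y - g z \<le> e" if "z \<in> F y" for z
      using cInf_lower[OF _ bdd, of "g z"] F_trans[OF y(1) that] y(2) by auto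
    with y(1) show ?thesis by blast
  qed
  have "\<exists>X. \<forall>n. (X n \<in> F x0 \<and> (\<forall>z\<in>F (X n). g (X n) - g z \<le> inverse (real (Suc n)))) \<and> X (Suc n) \<in> F (X n)"
  proof (rule dependent_nat_choice)
    show "\<exists>x. x \<in> F x0 \<and> (\<forall>z\<in>F x. g x - g z \<le> inverse (real (Suc 0)))"
      using almost_min[OF x0, of "inverse (real (Suc 0))"] by auto
    fix x n assume "x \<in> F x0 \<and> (\<forall>z\<in>F x. g x - g z \<le> inverse (real (Suc n)))"
    then have x: "x \<in> F x0" by simp
    then have "x \<in> S" by (simp add: F_def)
    from almost_min[OF this, of "inverse (real (Suc (Suc n)))"] obtain y where
      "y \<in> F x" "\<forall>z\<in>F y. g y - g z \<le> inverse (real (Suc (Suc n)))" by auto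
    with F_trans[OF x] show "\<exists>y. (y \<in> F x0 \<and> (\<forall>z\<in>F y. g y - g z \<le> inverse (real (Suc (Suc n))))) \<and> y \<in> F x"
      by blast
  qed
  then obtain X where X0: "\<And>n. X n \<in> F x0" and X: "\<And>n z. z \<in> F (X n) \<Longrightarrow> g (X n) - g z \<le> inverse (real (Suc n))"
    and XS: "\<And>n. X (Suc n) \<in> F (X n)"
    by blast
  have mono: "X m \<in> F (X n)" if "n \<le> m" for m n
    using that
  proof (induction m rule: dec_induct)
    case base
    show ?case using F_refl X0 by (simp add: F_def)
  next
    case (step m)
    then show ?case using F_trans XS by blast
  qed
  have small: "c * dist (X n) z \<le> inverse (real (Suc n))" if "z \<in> F (X n)" for n z
    using X[OF that] that by (simp add: F_def)
  have inS: "X n \<in> S" for n using X0[of n] by (simp add: F_def)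
  have inv0: "(\<lambda>n. inverse (real (Suc n)) / c) \<longlonglongrightarrow> 0"
    using tendsto_divide[OF LIMSEQ_inverse_real_of_nat tendsto_const[of c]] c by simp
  have "Cauchy X"
  proof (rule metric_CauchyI)
    fix e :: real assume e: "0 < e"
    obtain N where N: "inverse (real (Suc N)) / c < e / 2"
      using order_tendstoD(2)[OF inv0, of "e/2"] e unfolding eventually_sequentially by auto
    have "dist (X N) (X m) < e / 2" if "N \<le> m" for m

    proof -
      have "dist (X N) (X m) \<le> inverse (real (Suc N)) / c"
        using small[OF mono[OF that]] c by (simp only: pos_le_divide_eq mult.commute)
      then show ?thesis using N by linarith
    qed
    then have "dist (X m) (X n) < e" if "N \<le> m" "N \<le> n" for m n
      using that dist_triangle3[of "X m" "X n" "X N"] by (smt (verit) field_sum_of_halves)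
    then show "\<exists>M. \<forall>m\<ge>M. \<forall>n\<ge>M. dist (X m) (X n) < e" by blast
  qed
  then obtain s where s: "s \<in> S" "X \<longlonglongrightarrow> s"
    using S inS unfolding complete_def by blast
  have gs: "(\<lambda>n. g (X n)) \<longlonglongrightarrow> g s"
    using continuous_on_tendsto_compose[OF g s(2,1)] inS by simp
  have sF: "s \<in> F x" if "\<And>n. N \<le> n \<Longrightarrow> X n \<in> F x" for x N
  proof -
    have "(\<lambda>n. g (X n) + c * dist x (X n)) \<longlonglongrightarrow> g s + c * dist x s"
      by (intro tendsto_intros gs s(2))
    then have "g s + c * dist x s \<le> g x"
      by (rule LIMSEQ_le_const2) (use that in \<open>auto simp: F_def\<close>)
    then show ?thesis using s by (simp add: F_def)
  qed
  show ?thesis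
  proof (rule that[of s])
    show "s \<in> S" by (rule s(1))
    show "g s + c * dist x0 s \<le> g x0" using sF[of 0 x0] X0 by (auto simp: F_def)
    fix y assume y: "y \<in> S" "y \<noteq> s"
    show "g s < g y + c * dist s y"
    proof (rule ccontr)
      assume "\<not> g s < g y + c * dist s y"
      then have "y \<in> F s" using y by (simp add: F_def)
      then have "y \<in> F (X n)" for n using F_trans[OF sF[of n "X n"]] mono by blast
      then have "dist (X n) y \<le> inverse (real (Suc n)) / c" for n
        using small[of y n] c by (simp only: pos_le_divide_eq mult.commute)
      then have "(\<lambda>n. dist (X n) y) \<longlonglongrightarrow> 0"
        by (intro tendsto_sandwich[OF _ _ tendsto_const inv0]) auto
      moreover have "(\<lambda>n. dist (X n) y) \<longlonglongrightarrow> dist s y" by (intro tendsto_intros s(2))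
      ultimately have "dist s y = 0" using LIMSEQ_unique by blast
      then show False using y by simp
    qed
  qed
qed

text \<open>
  Suppose that a point \<open>z\<close> near \<open>p\<close> is not in the closed set. Ekeland's principle, applied to the
  distance from \<open>z\<close>, yields a point \<open>s\<close> of the closed set from which no point of the set is closer to \<open>z\<close> by
  more than half of the displacement. But \<open>z - s\<close> is a contingent direction at \<open>s\<close>, and a short move in this
  direction gains almost the whole displacement.
\<close>

lemma contingent_cone_full_imp_ball_subset_closure:
  fixes R :: "'e::banach set"
  assumes p: "p \<in> closure R" and r: "0 < r"
    and cone: "\<And>s e \<epsilon> \<delta>. s \<in> closure R \<Longrightarrow> s \<in> ball p r \<Longrightarrow> 0 < \<epsilon> \<Longrightarrow> 0 < \<delta> \<Longrightarrow>
      \<exists>h y. 0 < h \<and> h \<le> \<delta> \<and> y \<in> R \<and> norm (y - s - h *\<^sub>R e) \<le> \<epsilon> * h"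
  shows "ball p (r/4) \<subseteq> closure R"
proof
  fix z assume z: "z \<in> ball p (r/4)"
  show "z \<in> closure R"
  proof (rule ccontr)
    assume zR: "z \<notin> closure R"
    define S where "S = closure R \<inter> cball p (r/2)"
    have "closed S" by (simp add: S_def closed_Int)
    then have S: "complete S" by (simp add: complete_eq_closed)
    have pS: "p \<in> S" using p r by (simp add: S_def)
    obtain s where s: "s \<in> S" and s1: "dist z s + (1/2) * dist p s \<le> dist z p"
      and s2: "\<And>y. y \<in> S \<Longrightarrow> y \<noteq> s \<Longrightarrow> dist z s < dist z y + (1/2) * dist s y"
    proof (rule ekeland_variational_principle[OF S pS, of "dist z" "1/2"])
      show "continuous_on S (dist z)" by (intro continuous_intros)
    qed (use that in auto)
    define d where "d = dist z s"
    have d: "0 < d" using zR s by (auto simp: d_def S_def)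
    have "dist z s + (1/2) * dist p s < r / 4" using s1 z by (simp add: dist_commute)
    then have ps: "dist p s < r / 2" using zero_le_dist[of z s] by linarith
    \<comment> \<open>This bound on \<open>h\<close> keeps the new point inside the ball in which \<open>s\<close> is optimal.\<close>
    define \<delta> where "\<delta> = min 1 ((r/2 - dist p s) / (2 * d))"
    have \<delta>: "0 < \<delta>" using ps d by (simp add: \<delta>_def)
    obtain h y where h: "0 < h" "h \<le> \<delta>" and y: "y \<in> R" "norm (y - s - h *\<^sub>R (z - s)) \<le> d / 4 * h"
      using cone[of s "d / 4" \<delta> "z - s"] s ps d \<delta> r by (auto simp: S_def)
    have h1: "h \<le> 1" "2 * (d * h) \<le> r/2 - dist p s"
      using h d by (auto simp: \<delta>_def pos_le_divide_eq algebra_simps)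
    have nzs: "norm (z - s) = d" by (simp add: d_def dist_norm)
    have nh: "norm (h *\<^sub>R (z - s)) = d * h" using h nzs by simp
    have dh: "0 < d * h" using d h by simp
    have ys1: "norm (y - s) \<le> d / 4 * h + d * h"
      using norm_triangle_ineq[of "y - s - h *\<^sub>R (z - s)" "h *\<^sub>R (z - s)"] y(2) nh by simp
    have ys2: "d * h \<le> norm (y - s) + d / 4 * h"
      using norm_triangle_ineq4[of "y - s" "y - s - h *\<^sub>R (z - s)"] y(2) nh by simp
    have "norm (y - z) \<le> norm (y - s - h *\<^sub>R (z - s)) + norm ((1 - h) *\<^sub>R (s - z))"
      using norm_triangle_ineq[of "y - s - h *\<^sub>R (z - s)" "(1 - h) *\<^sub>R (s - z)"]
      by (simp add: algebra_simps)
    also have "norm ((1 - h) *\<^sub>R (s - z)) = (1 - h) * d"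
      using h1 nzs by (simp add: norm_minus_commute)
    finally have yz: "norm (y - z) \<le> d - d * h + d / 4 * h" using y(2) by (simp add: algebra_simps)
    have "dist p y \<le> dist p s + norm (y - s)"
      by (metis dist_commute dist_norm dist_triangle)
    moreover have "norm (y - s) \<le> 2 * (d * h)" using ys1 dh by linarith
    ultimately have "dist p y \<le> r / 2" using h1(2) by linarith
    then have yS: "y \<in> S" using y(1) closure_subset by (auto simp: S_def)
    have "y \<noteq> s" using ys2 dh by auto
    from s2[OF yS this] have "d < norm (y - z) + (1/2) * norm (y - s)"
      by (simp add: d_def dist_norm norm_minus_commute)
    then show False using yz ys1 dh by linarith
  qed
qed

section \<open>Local solutions of differential equations\<close>

text \<open>
  Banach's fixed point theorem for the Picard operator. The time is clamped to \<open>[0, T]\<close>, so that the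
  operator acts on bounded continuous functions on the whole real line.
\<close>

lemma picard_local_solution:
  fixes f :: "'e::banach \<Rightarrow> 'e"
  assumes K: "0 \<le> K" and bound: "\<And>y. y \<in> cball x \<rho> \<Longrightarrow> norm (f y) \<le> K"
    and lip: "\<And>y z. y \<in> cball x \<rho> \<Longrightarrow> z \<in> cball x \<rho> \<Longrightarrow> norm (f y - f z) \<le> K * norm (y - z)"
    and \<rho>: "0 \<le> \<rho>" and T: "0 \<le> T" "K * T \<le> \<rho>" "K * T \<le> 1/2"
  obtains \<gamma> where "\<gamma> 0 = x" "\<And>t. t \<in> {0..T} \<Longrightarrow> \<gamma> t \<in> cball x \<rho>"
    "\<And>t. t \<in> {0..T} \<Longrightarrow> (\<gamma> has_vector_derivative f (\<gamma> t)) (at t within {0..T})"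
proof -
  define clamp where "clamp t = max 0 (min T t)" for t :: real
  have clamp: "clamp t \<in> {0..T}" for t using T by (auto simp: clamp_def)
  have clamp_id: "clamp t = t" if "t \<in> {0..T}" for t using that by (auto simp: clamp_def)
  have clamp_cont: "continuous_on UNIV clamp" unfolding clamp_def by (intro continuous_intros)
  define C where "C = PiC UNIV (\<lambda>_::real. cball x \<rho>)"
  have C: "g \<in> C \<longleftrightarrow> (\<forall>t. apply_bcontfun g t \<in> cball x \<rho>)" for g
    by (auto simp: C_def mem_PiC_iff)
  have "closed C" unfolding C_def by (intro closed_PiC) auto
  then have complete: "complete C" by (simp add: complete_eq_closed)
  have "const_bcontfun x \<in> C" using \<rho> by (simp add: C const_bcontfun.rep_eq)
  then have ne: "C \<noteq> {}" by blast
  define \<Phi> where "\<Phi> g t = x + integral {0..clamp t} (\<lambda>s. f (apply_bcontfun g s))" for g t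
  have "K-lipschitz_on (cball x \<rho>) f"
    using K lip by (intro lipschitz_onI) (auto simp: dist_norm)
  then have fcont: "continuous_on (cball x \<rho>) f" by (rule lipschitz_on_continuous_on)
  have fg: "continuous_on A (\<lambda>s. f (apply_bcontfun g s))" if "g \<in> C" for g A
    by (rule continuous_on_compose2[OF fcont]) (use that in \<open>auto simp: C\<close>)
  have small: "norm (\<Phi> g t - x) \<le> \<rho>" if "g \<in> C" for g t
  proof -
    have "norm (integral {0..clamp t} (\<lambda>s. f (apply_bcontfun g s))) \<le> K * (clamp t - 0)"
      by (rule integral_bound) (use clamp[of t] fg[OF that] that bound in \<open>auto simp: C\<close>)
    also have "\<dots> \<le> K * T" using clamp[of t] K by (intro mult_left_mono) auto
    finally show ?thesis using T by (simp add: \<Phi>_def)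
  qed
  have \<Phi>_cont: "continuous_on UNIV (\<Phi> g)" if "g \<in> C" for g
  proof -
    have "continuous_on {0..T} (\<lambda>u. integral {0..u} (\<lambda>s. f (apply_bcontfun g s)))"
      by (intro indefinite_integral_continuous_1 integrable_continuous_real fg that)
    then have "continuous_on UNIV (\<lambda>t. integral {0..clamp t} (\<lambda>s. f (apply_bcontfun g s)))"
      by (rule continuous_on_compose2[OF _ clamp_cont]) (use clamp in auto)
    then show ?thesis unfolding \<Phi>_def by (intro continuous_intros)
  qed
  have \<Phi>_bcont: "\<Phi> g \<in> bcontfun" if "g \<in> C" for g
  proof -
    have "range (\<Phi> g) \<subseteq> cball x \<rho>"
      using small[OF that] by (auto simp: dist_norm norm_minus_commute)
    then have "bounded (range (\<Phi> g))" using bounded_subset bounded_cball by blast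
    with \<Phi>_cont[OF that] show ?thesis by (simp add: bcontfun_def)
  qed
  define \<Psi> where "\<Psi> g = Bcontfun (\<Phi> g)" for g
  have \<Psi>: "apply_bcontfun (\<Psi> g) = \<Phi> g" if "g \<in> C" for g
    using \<Phi>_bcont[OF that] by (simp add: \<Psi>_def Bcontfun_inverse)
  have maps: "\<Psi> ` C \<subseteq> C"
    using small by (auto simp: C[of "\<Psi> _"] \<Psi> dist_norm norm_minus_commute)
  have contr: "dist (\<Psi> g) (\<Psi> h) \<le> (1/2) * dist g h" if gh: "g \<in> C" "h \<in> C" for g h
  proof (rule dist_bound)
    fix t
    have int: "(\<lambda>s. f (apply_bcontfun k s)) integrable_on {0..clamp t}" if "k \<in> C" for k
      by (intro integrable_continuous_real fg that)
    have "dist (apply_bcontfun (\<Psi> g) t) (apply_bcontfun (\<Psi> h) t)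
        = norm (integral {0..clamp t} (\<lambda>s. f (apply_bcontfun g s) - f (apply_bcontfun h s)))"
      using integral_diff[OF int[OF gh(1)] int[OF gh(2)]] by (simp add: \<Psi> gh \<Phi>_def dist_norm)
    also have "\<dots> \<le> (K * dist g h) * (clamp t - 0)"
    proof (rule integral_bound)
      show "0 \<le> clamp t" using clamp[of t] by simp
      show "continuous_on {0..clamp t} (\<lambda>s. f (apply_bcontfun g s) - f (apply_bcontfun h s))"
        by (intro continuous_on_diff fg gh)
      fix s
      have "norm (f (apply_bcontfun g s) - f (apply_bcontfun h s)) \<le> K * dist (apply_bcontfun g s) (apply_bcontfun h s)"
        using gh unfolding C dist_norm by (intro lip) auto
      also have "\<dots> \<le> K * dist g h" using K dist_bounded by (intro mult_left_mono) auto
      finally show "norm (f (apply_bcontfun g s) - f (apply_bcontfun h s)) \<le> K * dist g h" .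
    qed
    also have "\<dots> \<le> (K * dist g h) * T" using clamp[of t] K by (intro mult_left_mono) auto
    also have "\<dots> = (K * T) * dist g h" by simp
    also have "\<dots> \<le> (1/2) * dist g h" using T by (intro mult_right_mono) auto
    finally show "dist (apply_bcontfun (\<Psi> g) t) (apply_bcontfun (\<Psi> h) t) \<le> (1/2) * dist g h" .
  qed
  obtain g where g: "g \<in> C" "\<Psi> g = g"
    using Banach_fix[OF complete ne _ _ maps, of "1/2"] contr by auto
  have eq: "apply_bcontfun g t = x + integral {0..t} (\<lambda>s. f (apply_bcontfun g s))" if "t \<in> {0..T}" for t
    using \<Psi>[OF g(1)] clamp_id[OF that] g(2) by (metis \<Phi>_def)
  show ?thesis
  proof (rule that[of "apply_bcontfun g"])
    show "apply_bcontfun g 0 = x" using eq[of 0] T by simp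
    fix t assume t: "t \<in> {0..T}"
    show "apply_bcontfun g t \<in> cball x \<rho>" using g by (simp add: C)
    have "((\<lambda>u. x + integral {0..u} (\<lambda>s. f (apply_bcontfun g s))) has_vector_derivative
        0 + f (apply_bcontfun g t)) (at t within {0..T})"
      by (intro has_vector_derivative_add has_vector_derivative_const integral_has_vector_derivative fg g t)
    then show "(apply_bcontfun g has_vector_derivative f (apply_bcontfun g t)) (at t within {0..T})"
      by (intro has_vector_derivative_transform[OF t eq]) simp_all
  qed
qed

section \<open>Smooth maps and their second-order bounds\<close>

lemma bounded_linear_Cons:
  assumes "bounded_multilinear (Suc k) T" "length vs = k"
  shows "bounded_linear (\<lambda>h. T (h # vs))"
proof -
  obtain C where C: "\<And>ws. length ws = Suc k \<Longrightarrow> norm (T ws) \<le> C * prod_list (map norm ws)"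
    and lin: "\<And>ws i. length ws = Suc k \<Longrightarrow> i < Suc k \<Longrightarrow> linear (\<lambda>v. T (ws[i := v]))"
    using assms(1) unfolding bounded_multilinear_def by blast
  have "linear (\<lambda>v. T (v # vs))" using lin[of "0 # vs" 0] assms(2) by simp
  moreover have "norm (T (v # vs)) \<le> norm v * (C * prod_list (map norm vs))" for v
    using C[of "v # vs"] assms(2) by (simp add: ac_simps)
  ultimately show ?thesis

    by (intro bounded_linear_intro[where K = "C * prod_list (map norm vs)"])
      (auto dest: linear_add linear_scale)
qed

lemma prod_list_norm_nonneg: "0 \<le> prod_list (map norm vs)"
  by (induction vs) auto

text \<open>
  Fixing the arguments \<open>vs\<close> turns the tower of multilinear derivatives into ordinary Frechet derivatives;
  differentiability of \<open>D k\<close> in the operator norm gives a local uniform bound on \<open>D k\<close>.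
\<close>

lemma smooth_on_tower:
  assumes "smooth_on S f" "open S"
  obtains D where "\<And>x. x \<in> S \<Longrightarrow> D 0 x [] = f x"
    "\<And>k x vs. x \<in> S \<Longrightarrow> length vs = k \<Longrightarrow>
       ((\<lambda>y. D k y vs) has_derivative (\<lambda>h. D (Suc k) x (h # vs))) (at x)"
    "\<And>k x. x \<in> S \<Longrightarrow> \<exists>r>0. \<exists>M\<ge>0. ball x r \<subseteq> S \<and>
       (\<forall>y\<in>ball x r. \<forall>vs. length vs = k \<longrightarrow> norm (D k y vs) \<le> M * prod_list (map norm vs))"
proof -
  obtain D where D: "(\<forall>x\<in>S. D 0 x [] = f x) \<and> (\<forall>k. \<forall>x\<in>S. bounded_multilinear k (D k x)) \<and>
      (\<forall>k. \<forall>x\<in>S. \<forall>\<epsilon>>0. \<forall>\<^sub>F y in nhds x. \<forall>vs. length vs = k \<longrightarrow>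
            norm (D k y vs - D k x vs - D (Suc k) x ((y - x) # vs))
              \<le> \<epsilon> * norm (y - x) * prod_list (map norm vs))"
    using assms(1) unfolding smooth_on_def by (elim exE) (rule that)
  note D0 = D[THEN conjunct1, rule_format]
    and Dm = D[THEN conjunct2, THEN conjunct1, rule_format]
    and Dd = D[THEN conjunct2, THEN conjunct2, rule_format]
  have der: "((\<lambda>y. D k y vs) has_derivative (\<lambda>h. D (Suc k) x (h # vs))) (at x)"
    if x: "x \<in> S" and vs: "length vs = k" for k x vs
    unfolding has_derivative_at_alt
  proof (intro conjI allI impI)
    show "bounded_linear (\<lambda>h. D (Suc k) x (h # vs))"
      by (rule bounded_linear_Cons[OF Dm[OF x] vs])
    fix e :: real assume e: "0 < e"
    define P where "P = prod_list (map norm vs)"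
    have P: "0 \<le> P" by (simp add: P_def prod_list_norm_nonneg)
    have "0 < e / (P + 1)" using e P by simp
    from Dd[OF x this, of k] obtain d where d: "0 < d" "\<And>y. dist y x < d \<Longrightarrow>
        norm (D k y vs - D k x vs - D (Suc k) x ((y - x) # vs)) \<le> e / (P + 1) * norm (y - x) * P"
      using vs unfolding eventually_nhds_metric P_def by blast
    have "e / (P + 1) * norm (y - x) * P \<le> e * norm (y - x)" for y
    proof -
      have "e / (P + 1) * norm (y - x) * P = (e * norm (y - x)) * (P / (P + 1))" by simp
      also have "\<dots> \<le> (e * norm (y - x)) * 1" using e P by (intro mult_left_mono) auto
      finally show ?thesis by simp
    qed
    with d show "\<exists>d>0. \<forall>y. norm (y - x) < d \<longrightarrow>
        norm (D k y vs - D k x vs - D (Suc k) x ((y - x) # vs)) \<le> e * norm (y - x)"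
      by (intro exI[of _ d]) (metis dist_norm order_trans)
  qed
  have bdd: "\<exists>r>0. \<exists>M\<ge>0. ball x r \<subseteq> S \<and>
       (\<forall>y\<in>ball x r. \<forall>vs. length vs = k \<longrightarrow> norm (D k y vs) \<le> M * prod_list (map norm vs))"
    if x: "x \<in> S" for k x
  proof -
    obtain C1 where C1: "\<And>vs. length vs = k \<Longrightarrow> norm (D k x vs) \<le> C1 * prod_list (map norm vs)"
      using Dm[OF x, of k] unfolding bounded_multilinear_def by blast
    obtain C2 where C2: "\<And>vs. length vs = Suc k \<Longrightarrow> norm (D (Suc k) x vs) \<le> C2 * prod_list (map norm vs)"
      using Dm[OF x, of "Suc k"] unfolding bounded_multilinear_def by blast
    obtain d where d: "0 < d" "\<And>y vs. dist y x < d \<Longrightarrow> length vs = k \<Longrightarrow>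
        norm (D k y vs - D k x vs - D (Suc k) x ((y - x) # vs)) \<le> 1 * norm (y - x) * prod_list (map norm vs)"
      using Dd[OF x zero_less_one, of k] unfolding eventually_nhds_metric by blast
    obtain r0 where r0: "0 < r0" "ball x r0 \<subseteq> S" using assms(2) x open_contains_ball by blast
    define r where "r = min (min d r0) 1"
    have "norm (D k y vs) \<le> (1 + \<bar>C1\<bar> + \<bar>C2\<bar>) * prod_list (map norm vs)"
      if y: "y \<in> ball x r" and vs: "length vs = k" for y vs
    proof -
      define P where "P = prod_list (map norm vs)"
      have P: "0 \<le> P" by (simp add: P_def prod_list_norm_nonneg)
      have yx: "dist y x < d" "norm (y - x) \<le> 1"
        using y by (auto simp: r_def dist_norm norm_minus_commute)
      have 1: "norm (D k y vs - D k x vs - D (Suc k) x ((y - x) # vs)) \<le> P"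
        using d(2)[OF yx(1) vs] mult_right_mono[OF yx(2) P] by (simp add: P_def)
      have 2: "norm (D k x vs) \<le> \<bar>C1\<bar> * P"
        using C1[OF vs] mult_right_mono[OF abs_ge_self[of C1] P] by (simp add: P_def)
      have "norm (D (Suc k) x ((y - x) # vs)) \<le> C2 * (norm (y - x) * P)"
        using C2[of "(y - x) # vs"] vs by (simp add: P_def)
      also have "\<dots> \<le> \<bar>C2\<bar> * (norm (y - x) * P)" using P by (intro mult_right_mono) auto
      also have "\<dots> \<le> \<bar>C2\<bar> * (1 * P)" using P yx by (intro mult_left_mono mult_right_mono) auto
      finally have 3: "norm (D (Suc k) x ((y - x) # vs)) \<le> \<bar>C2\<bar> * P" by simp
      have "norm (D k y vs) = norm ((D k y vs - D k x vs - D (Suc k) x ((y - x) # vs))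
          + D k x vs + D (Suc k) x ((y - x) # vs) + 0)" by simp
      also have "\<dots> \<le> P + \<bar>C1\<bar> * P + \<bar>C2\<bar> * P + 0" by (rule norm_add_le4) (use 1 2 3 in auto)
      finally show ?thesis by (simp add: P_def algebra_simps)
    qed
    then show ?thesis
      using d(1) r0 by (intro exI[of _ r] conjI exI[of _ "1 + \<bar>C1\<bar> + \<bar>C2\<bar>"]) (auto simp: r_def)
  qed
  show ?thesis using that[OF D0 der bdd] .
qed

lemma smooth_on_has_derivative:
  assumes "smooth_on S f" "open S" "x \<in> S"
  shows "(f has_derivative frechet_derivative f (at x)) (at x)"
proof -
  obtain D where D0: "\<And>x. x \<in> S \<Longrightarrow> D 0 x [] = f x"
    and der: "\<And>k x vs. x \<in> S \<Longrightarrow> length vs = k \<Longrightarrow>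
       ((\<lambda>y. D k y vs) has_derivative (\<lambda>h. D (Suc k) x (h # vs))) (at x)"
    by (rule smooth_on_tower[OF assms(1,2)]) (rule that)
  have "(f has_derivative (\<lambda>h. D (Suc 0) x [h])) (at x)"
    using der[OF assms(3), of "[]" 0]
    by (rule has_derivative_transform_within_open[OF _ assms(2,3)]) (use D0 in auto)
  then show ?thesis using frechet_derivative_at by metis
qed

text \<open>
  The Lipschitz and Taylor estimates are the mean value inequality on a ball on which the first three entries of the derivative
  tower are bounded.
\<close>

lemma smooth_on_imp_C11_on:
  fixes f :: "'e::real_normed_vector \<Rightarrow> 'e"
  assumes "smooth_on S f" "open S" "p \<in> S"
  obtains r K where "0 < r" "ball p r \<subseteq> S" "C11_on (ball p r) f (\<lambda>x. frechet_derivative f (at x)) K"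
proof -
  obtain D where D0: "\<And>x. x \<in> S \<Longrightarrow> D 0 x [] = f x"
    and der: "\<And>k x vs. x \<in> S \<Longrightarrow> length vs = k \<Longrightarrow>
       ((\<lambda>y. D k y vs) has_derivative (\<lambda>h. D (Suc k) x (h # vs))) (at x)"
    and bdd: "\<And>k x. x \<in> S \<Longrightarrow> \<exists>r>0. \<exists>M\<ge>0. ball x r \<subseteq> S \<and>
       (\<forall>y\<in>ball x r. \<forall>vs. length vs = k \<longrightarrow> norm (D k y vs) \<le> M * prod_list (map norm vs))"
    by (rule smooth_on_tower[OF assms(1,2)]) (rule that)
  obtain r0 M0 where 0: "0 < r0" "0 \<le> M0" "ball p r0 \<subseteq> S"
    "\<And>y vs. y \<in> ball p r0 \<Longrightarrow> length vs = 0 \<Longrightarrow> norm (D 0 y vs) \<le> M0 * prod_list (map norm vs)"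
    using bdd[OF assms(3), of 0] by blast
  obtain r1 M1 where 1: "0 < r1" "0 \<le> M1"
    "\<And>y vs. y \<in> ball p r1 \<Longrightarrow> length vs = Suc 0 \<Longrightarrow> norm (D (Suc 0) y vs) \<le> M1 * prod_list (map norm vs)"
    using bdd[OF assms(3), of "Suc 0"] by blast
  obtain r2 M2 where 2: "0 < r2" "0 \<le> M2"
    "\<And>y vs. y \<in> ball p r2 \<Longrightarrow> length vs = Suc (Suc 0) \<Longrightarrow>
       norm (D (Suc (Suc 0)) y vs) \<le> M2 * prod_list (map norm vs)"
    using bdd[OF assms(3), of "Suc (Suc 0)"] by blast
  define r where "r = min r0 (min r1 r2)"
  have r: "0 < r" "r \<le> r0" "r \<le> r1" "r \<le> r2" using 0 1 2 by (auto simp: r_def)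
  define B where "B = ball p r"
  have B: "convex B" "open B" by (auto simp: B_def)
  have BS: "x \<in> S" "x \<in> ball p r0" "x \<in> ball p r1" "x \<in> ball p r2" if "x \<in> B" for x
    using that r 0(3) by (auto simp: B_def)
  define f' where "f' x = (\<lambda>h. D (Suc 0) x [h])" for x
  have f': "(f has_derivative f' x) (at x)" if "x \<in> B" for x
    unfolding f'_def using der[OF BS(1)[OF that], of "[]" 0]
    by (rule has_derivative_transform_within_open[OF _ assms(2) BS(1)[OF that]]) (use D0 in auto)
  have fd: "frechet_derivative f (at x) = f' x" if "x \<in> B" for x
    using frechet_derivative_at[OF f'[OF that]] by simp
  have lin: "bounded_linear (f' x)" if "x \<in> B" for x
    using f'[OF that] has_derivative_bounded_linear by blast
  have n0: "norm (f x) \<le> M0" if "x \<in> B" for x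
    using 0(4)[OF BS(2)[OF that], of "[]"] D0[OF BS(1)[OF that]] by simp
  have n1: "norm (f' x v) \<le> M1 * norm v" if "x \<in> B" for x v
    using 1(3)[OF BS(3)[OF that], of "[v]"] by (simp add: f'_def)
  have lip: "norm (f y - f x) \<le> M1 * norm (y - x)" if "x \<in> B" "y \<in> B" for x y
  proof (rule differentiable_bound[OF B(1) _ _ that(2,1)])
    show "(f has_derivative f' z) (at z within B)" if "z \<in> B" for z
      using f'[OF that] has_derivative_at_withinI by blast
    show "onorm (f' z) \<le> M1" if "z \<in> B" for z
      by (rule onorm_bound[OF 1(2)]) (use n1[OF that] in \<open>simp add: mult.commute\<close>)
  qed
  have lip': "norm (f' y v - f' x v) \<le> M2 * norm (y - x) * norm v" if xy: "x \<in> B" "y \<in> B" for x y v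
  proof -
    have "norm (f' y v - f' x v) \<le> (M2 * norm v) * norm (y - x)"
    proof (rule differentiable_bound[OF B(1) _ _ xy(2,1)])
      fix z assume z: "z \<in> B"
      show "((\<lambda>z. f' z v) has_derivative (\<lambda>h. D (Suc (Suc 0)) z [h, v])) (at z within B)"
        unfolding f'_def using der[OF BS(1)[OF z], of "[v]" "Suc 0"] has_derivative_at_withinI by auto
      have "norm (D (Suc (Suc 0)) z [h, v]) \<le> (M2 * norm v) * norm h" for h
        using 2(3)[OF BS(4)[OF z], of "[h, v]"] by (simp add: ac_simps)
      then show "onorm (\<lambda>h. D (Suc (Suc 0)) z [h, v]) \<le> M2 * norm v"
        by (intro onorm_bound) (use 2(2) in auto)
    qed
    then show ?thesis by (simp add: ac_simps)
  qed
  have taylor: "norm (f y - f x - f' x (y - x)) \<le> M2 * (norm (y - x))\<^sup>2" if xy: "x \<in> B" "y \<in> B" for x y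
  proof -
    interpret fx: bounded_linear "f' x" by (rule lin[OF xy(1)])
    define A where "A = B \<inter> cball x (norm (y - x))"
    have "norm ((f y - f' x y) - (f x - f' x x)) \<le> (M2 * norm (y - x)) * norm (y - x)"
    proof (rule differentiable_bound[of A])
      show "convex A" unfolding A_def using B(1) by (intro convex_Int) auto
      show "x \<in> A" "y \<in> A" using xy by (auto simp: A_def dist_norm norm_minus_commute)
      fix z assume z: "z \<in> A"
      then have zB: "z \<in> B" and zx: "norm (z - x) \<le> norm (y - x)"
        by (auto simp: A_def dist_norm norm_minus_commute)
      have "((\<lambda>u. f u - f' x u) has_derivative (\<lambda>h. f' z h - f' x h)) (at z)"
        by (intro has_derivative_diff f'[OF zB] fx.has_derivative has_derivative_ident)
      then show "((\<lambda>u. f u - f' x u) has_derivative (\<lambda>h. f' z h - f' x h)) (at z within A)"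
        by (rule has_derivative_at_withinI)
      have "norm (f' z h - f' x h) \<le> M2 * norm (y - x) * norm h" for h
      proof -
        have "M2 * norm (z - x) * norm h \<le> M2 * norm (y - x) * norm h"
          using zx 2(2) by (intro mult_right_mono mult_left_mono) auto
        then show ?thesis using lip'[OF xy(1) zB, of h] by linarith
      qed
      then show "onorm (\<lambda>h. f' z h - f' x h) \<le> M2 * norm (y - x)"
        by (intro onorm_bound) (use 2(2) in auto)
    qed
    then show ?thesis by (simp add: fx.diff power2_eq_square algebra_simps)
  qed
  define K where "K = M0 + M1 + M2"
  have K: "0 \<le> K" "M0 \<le> K" "M1 \<le> K" "M2 \<le> K" using 0 1 2 by (auto simp: K_def)
  have up: "a \<le> K * b" if "a \<le> M * b" "M \<le> K" "0 \<le> b" for a b M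
    using that by (meson mult_right_mono order_trans)
  have "C11_on B f (\<lambda>x. frechet_derivative f (at x)) K"
    unfolding C11_on_def
  proof (intro conjI ballI allI)
    show "0 \<le> K" by (rule K)
    fix x assume x: "x \<in> B"
    show "bounded_linear (frechet_derivative f (at x))" using lin[OF x] fd[OF x] by simp
    show "norm (f x) \<le> K" using n0[OF x] K by simp
    show "norm (frechet_derivative f (at x) v) \<le> K * norm v" for v
      unfolding fd[OF x] by (rule up[OF n1[OF x] K(3)]) simp
    fix y assume y: "y \<in> B"
    show "norm (f y - f x) \<le> K * norm (y - x)" by (rule up[OF lip[OF x y] K(3)]) simp
    show "norm (f y - f x - frechet_derivative f (at x) (y - x)) \<le> K * (norm (y - x))\<^sup>2"
      unfolding fd[OF x] by (rule up[OF taylor[OF x y] K(4)]) simp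
    show "norm (frechet_derivative f (at y) v - frechet_derivative f (at x) v) \<le> K * norm (y - x) * norm v" for v
      unfolding fd[OF x] fd[OF y] mult.assoc
      by (rule up[OF lip'[OF x y, unfolded mult.assoc] K(4)]) simp
  qed
  moreover have "ball p r \<subseteq> S" using BS(1) by (auto simp: B_def)
  ultimately show ?thesis using that[of r K] r(1) by (simp add: B_def)
qed

lemma smooth_on_bounded_linear_comp:
  assumes f: "smooth_on S f" and l: "bounded_linear l"
  shows "smooth_on S (\<lambda>x. l (f x))"
proof -
  interpret l: bounded_linear l by (rule l)
  obtain D where D: "(\<forall>x\<in>S. D 0 x [] = f x) \<and> (\<forall>k. \<forall>x\<in>S. bounded_multilinear k (D k x)) \<and>
      (\<forall>k. \<forall>x\<in>S. \<forall>\<epsilon>>0. \<forall>\<^sub>F y in nhds x. \<forall>vs. length vs = k \<longrightarrow>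
            norm (D k y vs - D k x vs - D (Suc k) x ((y - x) # vs))
              \<le> \<epsilon> * norm (y - x) * prod_list (map norm vs))"
    using f unfolding smooth_on_def by (elim exE) (rule that)
  note D0 = D[THEN conjunct1] and Dm = D[THEN conjunct2, THEN conjunct1]
    and Dd = D[THEN conjunct2, THEN conjunct2]
  obtain L where L: "0 < L" "\<And>x. norm (l x) \<le> norm x * L" using l.pos_bounded by blast
  show ?thesis
    unfolding smooth_on_def
  proof (intro exI[of _ "\<lambda>k x vs. l (D k x vs)"] conjI allI ballI impI)
    fix x assume x: "x \<in> S"
    show "l (D 0 x []) = l (f x)" using D0 x by simp
    fix k
    have Dk: "bounded_multilinear k (D k x)" using Dm x by simp
    then obtain C where C: "\<And>vs. length vs = k \<Longrightarrow> norm (D k x vs) \<le> C * prod_list (map norm vs)"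
      unfolding bounded_multilinear_def by blast
    show "bounded_multilinear k (\<lambda>vs. l (D k x vs))"
      unfolding bounded_multilinear_def
    proof (intro conjI allI impI exI[of _ "C * L"])
      fix vs :: "'a list" and i assume "length vs = k \<and> i < k"
      then have "linear (\<lambda>v. D k x (vs[i := v]))" using Dk by (simp add: bounded_multilinear_def)
      then show "linear (\<lambda>v. l (D k x (vs[i := v])))"
        using linear_compose[OF _ l.linear] by (simp add: o_def)
    next
      fix vs :: "'a list" assume "length vs = k"
      then have "norm (D k x vs) * L \<le> (C * prod_list (map norm vs)) * L"
        using C L(1) by (intro mult_right_mono) auto
      then show "norm (l (D k x vs)) \<le> C * L * prod_list (map norm vs)"
        using L(2)[of "D k x vs"] by (simp add: ac_simps)
    qed
    fix \<epsilon> :: real assume "0 < \<epsilon>"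
    then have "0 < \<epsilon> / L" using L(1) by simp
    from Dd[rule_format, OF x this, of k]
    show "\<forall>\<^sub>F y in nhds x. \<forall>vs. length vs = k \<longrightarrow>
        norm (l (D k y vs) - l (D k x vs) - l (D (Suc k) x ((y - x) # vs)))
          \<le> \<epsilon> * norm (y - x) * prod_list (map norm vs)"
    proof (rule eventually_mono, intro allI impI)
      fix y and vs :: "'a list"
      assume *: "\<forall>vs. length vs = k \<longrightarrow> norm (D k y vs - D k x vs - D (Suc k) x ((y - x) # vs))
              \<le> \<epsilon> / L * norm (y - x) * prod_list (map norm vs)" and vs: "length vs = k"
      have "norm (l (D k y vs) - l (D k x vs) - l (D (Suc k) x ((y - x) # vs)))
          \<le> norm (D k y vs - D k x vs - D (Suc k) x ((y - x) # vs)) * L"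
        using L(2)[of "D k y vs - D k x vs - D (Suc k) x ((y - x) # vs)"] by (simp add: l.diff)
      also have "\<dots> \<le> \<epsilon> / L * norm (y - x) * prod_list (map norm vs) * L"
        using * vs L(1) by (intro mult_right_mono) auto
      finally show "norm (l (D k y vs) - l (D k x vs) - l (D (Suc k) x ((y - x) # vs)))
          \<le> \<epsilon> * norm (y - x) * prod_list (map norm vs)" using L(1) by (simp add: ac_simps)
    qed
  qed
qed

section \<open>Charts, tangent vectors and brackets in coordinates\<close>

text \<open>
  A bump function cannot be constant along the line in direction \<open>v\<close> through a point where it is not \<open>0\<close>,
  so by the mean value theorem one of its derivatives does not vanish on \<open>v\<close>.
\<close>

lemma bump_separates_points:
  fixes v :: "'e::real_normed_vector"
  assumes b: "lipschitz_C1_bump (b :: 'e \<Rightarrow> real)" and v: "v \<noteq> 0"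
  shows "\<exists>l :: 'e \<Rightarrow> real. bounded_linear l \<and> l v \<noteq> 0"
proof -
  obtain x where x: "b x \<noteq> 0" using b by (auto simp: lipschitz_C1_bump_def)
  obtain b' :: "'e \<Rightarrow> 'e \<Rightarrow>\<^sub>L real" where b': "\<And>x. (b has_derivative blinfun_apply (b' x)) (at x)"
    using b by (auto simp: lipschitz_C1_bump_def)
  obtain M where M: "\<And>y. b y \<noteq> 0 \<Longrightarrow> norm y \<le> M"
    using b unfolding lipschitz_C1_bump_def bounded_iff by blast
  define t where "t = (M + norm x + 1) / norm v"
  have "0 \<le> M" using M[OF x] norm_ge_zero order_trans by blast
  then have t: "0 < t" using v by (simp add: t_def add_nonneg_pos)
  have "norm (x + t *\<^sub>R v) > M"
  proof -
    have "norm (t *\<^sub>R v) = M + norm x + 1" using t v \<open>0 \<le> M\<close> by (simp add: t_def add_nonneg_nonneg)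
    then show ?thesis using norm_triangle_ineq4[of "x + t *\<^sub>R v" x] by simp
  qed
  then have bt: "b (x + t *\<^sub>R v) = 0" using M by force
  have der: "((\<lambda>s. b (x + s *\<^sub>R v)) has_real_derivative b' (x + s *\<^sub>R v) v) (at s)" for s :: real
  proof -
    have "((\<lambda>s. x + s *\<^sub>R v) has_derivative (\<lambda>s. s *\<^sub>R v)) (at s)"
      by (auto intro!: derivative_eq_intros)
    from has_derivative_compose[OF this b']
    show ?thesis by (simp add: has_field_derivative_def blinfun.scaleR_right mult_commute_abs)
  qed
  obtain s where "b (x + t *\<^sub>R v) - b (x + 0 *\<^sub>R v) = (t - 0) * b' (x + s *\<^sub>R v) v"
    using MVT2[OF t, of "\<lambda>s. b (x + s *\<^sub>R v)" "\<lambda>s. b' (x + s *\<^sub>R v) v"] der by blast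
  then have "b' (x + s *\<^sub>R v) v \<noteq> 0" using bt x by auto
  then show ?thesis using blinfun.bounded_linear_right by blast
qed

locale banach_atlas =
  fixes X :: "'m topology" and A :: "('m, 'e::banach) chart set"
  assumes manifold: "banach_manifold X A"
begin

lemma chart_homeomorphic:
  assumes "c \<in> A"
  shows "openin X (fst c)" "open (snd c ` fst c)"
    "homeomorphic_map (subtopology X (fst c)) (top_of_set (snd c ` fst c)) (snd c)"
proof -
  have "\<forall>(U, \<phi>)\<in>A. openin X U \<and> open (\<phi> ` U) \<and>
      homeomorphic_map (subtopology X U) (top_of_set (\<phi> ` U)) \<phi>"
    using manifold unfolding banach_manifold_def by blast
  from bspec[OF this assms] show "openin X (fst c)" "open (snd c ` fst c)"
    "homeomorphic_map (subtopology X (fst c)) (top_of_set (snd c ` fst c)) (snd c)"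
    by (simp_all add: case_prod_beta)
qed

lemma chart_subset: "c \<in> A \<Longrightarrow> fst c \<subseteq> topspace X"
  using chart_homeomorphic(1) openin_subset by blast

lemma chart_inj: "c \<in> A \<Longrightarrow> inj_on (snd c) (fst c)"
  using chart_homeomorphic(3)[of c] chart_subset[of c]
  by (simp add: homeomorphic_eq_everything_map Int_absorb1)

lemma chart_inv_chart: "c \<in> A \<Longrightarrow> q \<in> fst c \<Longrightarrow> chart_inv c (snd c q) = q"
  by (simp add: chart_inj)

lemma chart_exists: "q \<in> topspace X \<Longrightarrow> \<exists>c. c \<in> charts_at A q"
  using manifold unfolding banach_manifold_def charts_at_def by blast

lemma charts_atD: "c \<in> charts_at A q \<Longrightarrow> c \<in> A \<and> q \<in> fst c"
  by (simp add: charts_at_def)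

lemma open_chart_image:
  assumes c: "c \<in> A" and N: "openin X N"
  shows "open (snd c ` (fst c \<inter> N))"
proof -
  have "openin (subtopology X (fst c)) (fst c \<inter> N)"
    using N openin_subtopology_Int2 by blast
  then have "openin (top_of_set (snd c ` fst c)) (snd c ` (fst c \<inter> N))"
    using homeomorphic_imp_open_map[OF chart_homeomorphic(3)[OF c]] by (simp add: open_map_def)
  then show ?thesis using chart_homeomorphic(2)[OF c] openin_open_eq by blast
qed

lemma openin_chart_preimage:
  assumes c: "c \<in> A" and W: "open W"
  shows "openin X {q \<in> fst c. snd c q \<in> W}"
proof -
  have "continuous_map (subtopology X (fst c)) (top_of_set (snd c ` fst c)) (snd c)"
    by (rule homeomorphic_imp_continuous_map[OF chart_homeomorphic(3)[OF c]])
  then have "continuous_map (subtopology X (fst c)) euclidean (snd c)"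
    using continuous_map_in_subtopology by blast
  then have "openin (subtopology X (fst c)) {q \<in> topspace (subtopology X (fst c)). snd c q \<in> W}"
    by (rule openin_continuous_map_preimage) (use W in \<open>simp only: open_openin[symmetric]\<close>)
  moreover have tops: "topspace (subtopology X (fst c)) = fst c"
    by (simp only: topspace_subtopology Int_absorb1[OF chart_subset[OF c]])
  ultimately have "openin (subtopology X (fst c)) {q \<in> fst c. snd c q \<in> W}"
    by (simp only: tops)
  then show ?thesis by (rule openin_trans_full[OF _ chart_homeomorphic(1)[OF c]])
qed

lemma continuous_map_chart_inv:
  assumes c: "c \<in> A"
  shows "continuous_map (top_of_set (snd c ` fst c)) X (chart_inv c)"
proof -
  have "openin (top_of_set (snd c ` fst c)) {x \<in> snd c ` fst c. chart_inv c x \<in> N}" if N: "openin X N" for N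
  proof -
    have "{x \<in> snd c ` fst c. chart_inv c x \<in> N} = snd c ` (fst c \<inter> N)"
      using chart_inv_chart[OF c] by force
    with open_chart_image[OF c N] show ?thesis
      using chart_homeomorphic(2)[OF c] by (simp add: openin_open_eq image_mono)
  qed
  moreover have "chart_inv c x \<in> topspace X" if "x \<in> snd c ` fst c" for x
    using inv_into_into[OF that] chart_subset[OF c] by blast
  ultimately show ?thesis by (simp add: continuous_map_def Pi_iff)
qed

lemma smooth_transition:
  assumes "c \<in> A" "d \<in> A"
  shows "smooth_on (snd c ` (fst c \<inter> fst d)) (snd d \<circ> chart_inv c)"
  using manifold assms unfolding banach_manifold_def by blast

definition transition_derivative :: "('m, 'e) chart \<Rightarrow> ('m, 'e) chart \<Rightarrow> 'm \<Rightarrow> 'e \<Rightarrow> 'e" where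
  "transition_derivative c d q = frechet_derivative (snd d \<circ> chart_inv c) (at (snd c q))"

lemma has_derivative_transition:
  assumes "c \<in> charts_at A q" "d \<in> charts_at A q"
  shows "((snd d \<circ> chart_inv c) has_derivative transition_derivative c d q) (at (snd c q))"
proof -
  have c: "c \<in> A" "q \<in> fst c" and d: "d \<in> A" "q \<in> fst d" using assms charts_atD by auto
  show ?thesis
    unfolding transition_derivative_def
    by (rule smooth_on_has_derivative[OF smooth_transition[OF c(1) d(1)]
          open_chart_image[OF c(1) chart_homeomorphic(1)[OF d(1)]]]) (use c d in auto)
qed

text \<open>
  Near \<open>q\<close> one has \<open>f \<circ> d\<^sup>-\<^sup>1 = (f \<circ> c\<^sup>-\<^sup>1) \<circ> (c \<circ> d\<^sup>-\<^sup>1)\<close>, so this is the chain rule. It yields both the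
  cocycle rule for transition derivatives and the independence of the derivative of \<open>f\<close> along a vector field from
  the chart.
\<close>

lemma has_derivative_change_of_chart:
  fixes f :: "'m \<Rightarrow> 'f::real_normed_vector"
  assumes c: "c \<in> charts_at A q" and d: "d \<in> charts_at A q"
    and f: "((f \<circ> chart_inv c) has_derivative f') (at (snd c q))"
  shows "((f \<circ> chart_inv d) has_derivative (\<lambda>v. f' (transition_derivative d c q v))) (at (snd d q))"
proof -
  have c': "c \<in> A" "q \<in> fst c" and d': "d \<in> A" "q \<in> fst d" using c d charts_atD by auto
  have "((f \<circ> chart_inv c) has_derivative f') (at ((snd c \<circ> chart_inv d) (snd d q)))"
    using f chart_inv_chart[OF d'] by simp
  from has_derivative_compose[OF has_derivative_transition[OF d c] this]
  have *: "((\<lambda>x. (f \<circ> chart_inv c) ((snd c \<circ> chart_inv d) x)) has_derivative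
      (\<lambda>v. f' (transition_derivative d c q v))) (at (snd d q))" .
  show ?thesis
    by (rule has_derivative_transform_within_open[OF *
          open_chart_image[OF d'(1) chart_homeomorphic(1)[OF c'(1)]]])
      (use c' d' in \<open>auto simp: chart_inv_chart\<close>)
qed

lemma transition_derivative_trans:
  assumes "c \<in> charts_at A q" "d \<in> charts_at A q" "b \<in> charts_at A q"
  shows "transition_derivative c d q (transition_derivative b c q v) = transition_derivative b d q v"
  using has_derivative_unique[OF has_derivative_transition[OF assms(3,2)]
      has_derivative_change_of_chart[OF assms(1,3) has_derivative_transition[OF assms(1,2)]]]
  by (metis)

lemma transition_derivative_refl:
  assumes "c \<in> charts_at A q"
  shows "transition_derivative c c q v = v"
proof -
  have c: "c \<in> A" "q \<in> fst c" using assms charts_atD by auto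
  have "((snd c \<circ> chart_inv c) has_derivative (\<lambda>v. v)) (at (snd c q))"
    by (rule has_derivative_transform_within_open[OF has_derivative_ident chart_homeomorphic(2)[OF c(1)]])
      (use c in \<open>auto simp: f_inv_into_f\<close>)
  from has_derivative_unique[OF has_derivative_transition[OF assms assms] this] show ?thesis by metis
qed

lemma tangent_change_of_chart:
  assumes "v \<in> tangent_space A q" "c \<in> charts_at A q" "d \<in> charts_at A q"
  shows "transition_derivative c d q (v c) = v d"
proof -
  have "v d = frechet_derivative (snd d \<circ> chart_inv c) (at (snd c q)) (v c)"
    using assms unfolding tangent_space_def by blast
  then show ?thesis by (simp only: transition_derivative_def)
qed

text \<open>
  The coordinate map of a chart is onto the model space: transport \<open>e\<close> to the other charts by the
  transition derivatives, which are compatible by the cocycle rule.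
\<close>

lemma tangent_with_coordinate:
  assumes c: "c \<in> charts_at A q"
  obtains v where "v \<in> tangent_space A q" "v c = e"
proof -
  define v where "v d = (if d \<in> charts_at A q then transition_derivative c d q e else 0)" for d
  have "v \<in> tangent_space A q"
    unfolding tangent_space_def mem_Collect_eq transition_derivative_def[symmetric]
  proof (intro conjI allI ballI impI)
    show "v d = 0" if "d \<notin> charts_at A q" for d using that by (simp add: v_def)
    show "v b = transition_derivative d b q (v d)" if "d \<in> charts_at A q" "b \<in> charts_at A q" for b d
      using that transition_derivative_trans[OF that c] by (simp add: v_def)
  qed
  moreover have "v c = e" using transition_derivative_refl[OF c] c by (simp add: v_def)
  ultimately show ?thesis using that by blast
qed

lemma vf_action_in_chart:
  assumes c: "c \<in> charts_at A q" and W: "W q \<in> tangent_space A q"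
    and f: "((f \<circ> chart_inv c) has_derivative f') (at (snd c q))"
  shows "vf_action A W f q = f' (W q c)"
proof -
  define d where "d = (SOME d. d \<in> charts_at A q)"
  have d: "d \<in> charts_at A q" using c unfolding d_def by (rule someI)
  have "vf_action A W f q = frechet_derivative (f \<circ> chart_inv d) (at (snd d q)) (W q d)"
    unfolding vf_action_def Let_def d_def ..
  also have "frechet_derivative (f \<circ> chart_inv d) (at (snd d q)) = (\<lambda>v. f' (transition_derivative d c q v))"
    using frechet_derivative_at[OF has_derivative_change_of_chart[OF c d f]] by simp
  also have "f' (transition_derivative d c q (W q d)) = f' (W q c)"
    using tangent_change_of_chart[OF W d c] by simp
  finally show ?thesis .
qed

definition coordinates :: "('m, 'e) chart \<Rightarrow> ('m \<Rightarrow> ('m, 'e) tangent) \<Rightarrow> 'e \<Rightarrow> 'e" where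
  "coordinates c V x = V (chart_inv c x) c"

lemma coordinates_smooth:
  assumes "smooth_vector_field X A V" "c \<in> A"
  shows "smooth_on (snd c ` fst c) (coordinates c V)"
  using assms unfolding smooth_vector_field_def coordinates_def by blast

lemma vector_field_tangent:
  "smooth_vector_field X A V \<Longrightarrow> q \<in> topspace X \<Longrightarrow> V q \<in> tangent_space A q"
  unfolding smooth_vector_field_def by blast

lemma smooth_function_linear_coordinate:
  assumes c: "c \<in> A" and l: "bounded_linear l"
  shows "smooth_function_on A (fst c) (\<lambda>q. l (snd c q))"
  unfolding smooth_function_on_def
proof
  fix d assume d: "d \<in> A"
  show "smooth_on (snd d ` (fst d \<inter> fst c)) ((\<lambda>q. l (snd c q)) \<circ> chart_inv d)"
    using smooth_on_bounded_linear_comp[OF smooth_transition[OF d c] l] by (simp add: o_def)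
qed

text \<open>
  The bracket is given by its action on local functions. Testing it on \<open>l \<circ> \<phi>\<close>, where \<open>\<phi>\<close> is the map of
  the chart and \<open>l\<close> a bounded functional, gives the image of the familiar coordinate formula under \<open>l\<close>; the
  formula follows because the functionals separate points.
\<close>

lemma bracket_in_coordinates:
  assumes sep: "\<forall>v::'e. v \<noteq> 0 \<longrightarrow> (\<exists>l :: 'e \<Rightarrow> real. bounded_linear l \<and> l v \<noteq> 0)"
    and V: "smooth_vector_field X A V" and W: "smooth_vector_field X A W"
    and Z: "is_lie_bracket X A V W Z" and c: "c \<in> A" and x: "x \<in> snd c ` fst c"
  shows "coordinates c Z x = frechet_derivative (coordinates c W) (at x) (coordinates c V x)
     - frechet_derivative (coordinates c V) (at x) (coordinates c W x)"
proof -
  obtain q where q: "q \<in> fst c" "x = snd c q" using x by auto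
  have cq: "c \<in> charts_at A p" if "p \<in> fst c" for p using c that by (simp add: charts_at_def)
  have top: "p \<in> topspace X" if "p \<in> fst c" for p using that chart_subset[OF c] by blast
  have inv: "chart_inv c (snd c p) = p" if "p \<in> fst c" for p by (rule chart_inv_chart[OF c that])
  have Zs: "smooth_vector_field X A Z" using Z by (simp add: is_lie_bracket_def)
  have "l (coordinates c Z x) = l (frechet_derivative (coordinates c W) (at x) (coordinates c V x)
     - frechet_derivative (coordinates c V) (at x) (coordinates c W x))" if l: "bounded_linear l"
    for l :: "'e \<Rightarrow> real"
  proof -
    interpret l: bounded_linear l by (rule l)
    define f where "f q = l (snd c q)" for q
    have first: "vf_action A Y f p = l (Y p c)"
      if Y: "smooth_vector_field X A Y" and p: "p \<in> fst c" for Y p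
    proof (rule vf_action_in_chart[of c p Y, OF cq[OF p] vector_field_tangent[OF Y top[OF p]]])
      have *: "(l has_derivative l) (at (snd c p))" by (rule l.has_derivative[OF has_derivative_ident])
      show "((f \<circ> chart_inv c) has_derivative l) (at (snd c p))"
        by (rule has_derivative_transform_within_open[OF * chart_homeomorphic(2)[OF c]])
          (use p in \<open>auto simp: f_def f_inv_into_f\<close>)
    qed
    have second: "vf_action A U (vf_action A Y f) q
        = l (frechet_derivative (coordinates c Y) (at x) (coordinates c U x))"
      if Y: "smooth_vector_field X A Y" and U: "smooth_vector_field X A U" for Y U
    proof -
      have "(coordinates c Y has_derivative frechet_derivative (coordinates c Y) (at x)) (at x)"
        by (rule smooth_on_has_derivative[OF coordinates_smooth[OF Y c] chart_homeomorphic(2)[OF c] x])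
      from l.has_derivative[OF this]
      have *: "((\<lambda>y. l (coordinates c Y y)) has_derivative
          (\<lambda>v. l (frechet_derivative (coordinates c Y) (at x) v))) (at x)" .
      have "((vf_action A Y f \<circ> chart_inv c) has_derivative
          (\<lambda>v. l (frechet_derivative (coordinates c Y) (at x) v))) (at (snd c q))"
        unfolding q(2)[symmetric]
      proof (rule has_derivative_transform_within_open[OF * chart_homeomorphic(2)[OF c] x])
        fix y assume "y \<in> snd c ` fst c"
        then obtain p where "p \<in> fst c" "y = snd c p" by auto
        then show "l (coordinates c Y y) = (vf_action A Y f \<circ> chart_inv c) y"
          by (simp add: coordinates_def inv first[OF Y])
      qed
      from vf_action_in_chart[of c q U, OF cq[OF q(1)] vector_field_tangent[OF U top[OF q(1)]] this]
      show ?thesis using q inv by (simp add: coordinates_def)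
    qed
    have "vf_action A Z f q = vf_action A V (vf_action A W f) q - vf_action A W (vf_action A V f) q"
      using Z chart_homeomorphic(1)[OF c] smooth_function_linear_coordinate[OF c l] q(1)
      unfolding is_lie_bracket_def f_def by blast
    then show ?thesis
      unfolding second[OF W V] second[OF V W] first[OF Zs q(1)] l.diff
      using q inv by (simp add: coordinates_def)
  qed
  note eq = this
  have "l (coordinates c Z x - (frechet_derivative (coordinates c W) (at x) (coordinates c V x)
     - frechet_derivative (coordinates c V) (at x) (coordinates c W x))) = 0"
    if "bounded_linear l" for l :: "'e \<Rightarrow> real"
  proof -
    interpret l: bounded_linear l by (rule that)
    show ?thesis using eq[OF that] by (simp add: l.diff)
  qed
  then show ?thesis using sep right_minus_eq by metis
qed

end

section \<open>Following a vector field from a reachable point\<close>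

definition constant_control :: "nat \<Rightarrow> real \<Rightarrow> nat \<Rightarrow> real" where
  "constant_control i \<sigma> j = (if j = i then \<sigma> else 0)"

lemma admissible_control_append:
  assumes u: "admissible_control u" and \<sigma>: "\<sigma> \<in> {-1, 1}"
  shows "admissible_control (\<lambda>t. if t \<le> T0 then u t else constant_control i \<sigma>)"
  unfolding admissible_control_def
proof (intro conjI allI impI)
  show "piecewise_constant (\<lambda>t. if t \<le> T0 then u t else constant_control i \<sigma>)"
    unfolding piecewise_constant_def
  proof
    fix T
    obtain F where F: "finite F"
      "\<And>s t. 0 \<le> s \<Longrightarrow> s \<le> t \<Longrightarrow> t \<le> T \<Longrightarrow> {s..t} \<inter> F = {} \<Longrightarrow> u s = u t"
      using u unfolding admissible_control_def piecewise_constant_def by metis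
    have "(if s \<le> T0 then u s else constant_control i \<sigma>) = (if t \<le> T0 then u t else constant_control i \<sigma>)"
      if "0 \<le> s" "s \<le> t" "t \<le> T" "{s..t} \<inter> insert T0 F = {}" for s t
    proof -
      have "T0 < s \<or> t < T0" "{s..t} \<inter> F = {}" using that by force+
      then show ?thesis using F(2)[OF that(1-3)] that(2) by auto
    qed
    then show "\<exists>F. finite F \<and> (\<forall>s t. 0 \<le> s \<and> s \<le> t \<and> t \<le> T \<and> {s..t} \<inter> F = {} \<longrightarrow>
        (if s \<le> T0 then u s else constant_control i \<sigma>) = (if t \<le> T0 then u t else constant_control i \<sigma>))"
      using F(1) by (intro exI[of _ "insert T0 F"]) blast
  qed
  have fin: "finite {j. constant_control i \<sigma> j \<noteq> 0}"
    by (rule finite_subset[of _ "{i}"]) (auto simp: constant_control_def)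
  fix t :: real assume t: "0 \<le> t"
  show "finite {j. (if t \<le> T0 then u t else constant_control i \<sigma>) j \<noteq> 0}"
    using fin u t by (simp add: admissible_control_def)
  show "(if t \<le> T0 then u t else constant_control i \<sigma>) j \<in> {-1, 0, 1}" for j
    using u t \<sigma> unfolding admissible_control_def constant_control_def by auto
qed

context banach_atlas
begin

text \<open>
  In the chart \<open>c\<close> the added piece solves the equation by hypothesis; in any other chart the velocity
  is transported by the transition derivative. The switching time and the end points of the time interval join
  the finite set of exceptional times, so that only derivatives at interior points matter.
\<close>

lemma trajectory_append:
  assumes traj: "trajectory X A V u q0 T0 q" and T0: "0 \<le> T0" and T: "0 \<le> T"
    and V: "smooth_vector_field X A (V i)" and \<sigma>: "\<sigma> \<noteq> 0" and c: "c \<in> A" and qT: "q T0 \<in> fst c"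
    and \<gamma>0: "\<gamma> 0 = snd c (q T0)" and \<gamma>: "\<And>t. t \<in> {0..T} \<Longrightarrow> \<gamma> t \<in> snd c ` fst c"
    and \<gamma>': "\<And>t. t \<in> {0..T} \<Longrightarrow>
      (\<gamma> has_vector_derivative \<sigma> *\<^sub>R coordinates c (V i) (\<gamma> t)) (at t within {0..T})"
  shows "trajectory X A V (\<lambda>t. if t \<le> T0 then u t else constant_control i \<sigma>) q0 (T0 + T)
     (\<lambda>t. if t \<le> T0 then q t else chart_inv c (\<gamma> (t - T0)))"
    (is "trajectory X A V ?u q0 (T0 + T) ?q")
proof -
  obtain F where qc: "continuous_map (top_of_set {0..T0}) X q" and q0: "q 0 = q0" and F: "finite F"
    and qd: "\<And>t c. t \<in> {0..T0} - F \<Longrightarrow> c \<in> charts_at A (q t) \<Longrightarrow>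
           ((snd c \<circ> q) has_vector_derivative (\<Sum>i | u t i \<noteq> 0. u t i *\<^sub>R V i (q t) c))
             (at t within {0..T0})"
    using traj unfolding trajectory_def by blast
  have \<gamma>c: "continuous_on {0..T} \<gamma>"
    using \<gamma>' has_vector_derivative_continuous continuous_on_eq_continuous_within by blast
  have cont: "continuous_map (top_of_set {0..T0+T}) X ?q"
  proof (rule continuous_map_cases_le)
    show "continuous_map (top_of_set {0..T0+T}) euclideanreal (\<lambda>t. t)"
      "continuous_map (top_of_set {0..T0+T}) euclideanreal (\<lambda>t. T0)" by auto
    have "subtopology (top_of_set {0..T0+T}) {x \<in> topspace (top_of_set {0..T0+T}). x \<le> T0} = top_of_set {0..T0}"
      using T by (simp add: subtopology_subtopology) (rule arg_cong[where f=top_of_set], auto)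
    then show "continuous_map (subtopology (top_of_set {0..T0+T}) {x \<in> topspace (top_of_set {0..T0+T}). x \<le> T0}) X q"
      using qc by simp
    have e: "subtopology (top_of_set {0..T0+T}) {x \<in> topspace (top_of_set {0..T0+T}). T0 \<le> x} = top_of_set {T0..T0+T}"
      using T0 by (simp add: subtopology_subtopology) (rule arg_cong[where f=top_of_set], auto)
    have "continuous_on {T0..T0+T} (\<lambda>t. \<gamma> (t - T0))"
      by (rule continuous_on_compose2[OF \<gamma>c]) (auto intro!: continuous_intros)
    then have "continuous_map (top_of_set {T0..T0+T}) (top_of_set (snd c ` fst c)) (\<lambda>t. \<gamma> (t - T0))"
      using \<gamma> by (auto simp: continuous_map_in_subtopology)
    from continuous_map_compose[OF this continuous_map_chart_inv[OF c]]
    show "continuous_map (subtopology (top_of_set {0..T0+T}) {x \<in> topspace (top_of_set {0..T0+T}). T0 \<le> x}) X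
        (\<lambda>t. chart_inv c (\<gamma> (t - T0)))"
      unfolding e by (simp add: o_def)
    show "q x = chart_inv c (\<gamma> (x - T0))" if "x = T0" for x
      using that chart_inv_chart[OF c qT] \<gamma>0 by simp
  qed
  have der: "((snd d \<circ> ?q) has_vector_derivative (\<Sum>j | ?u t j \<noteq> 0. ?u t j *\<^sub>R V j (?q t) d))
             (at t within {0..T0+T})"
    if t: "t \<in> {0..T0+T} - (F \<union> {0, T0, T0+T})" and d: "d \<in> charts_at A (?q t)" for t d
  proof (rule has_vector_derivative_at_within)
    show "((snd d \<circ> ?q) has_vector_derivative (\<Sum>j | ?u t j \<noteq> 0. ?u t j *\<^sub>R V j (?q t) d)) (at t)"
    proof (cases "t < T0")
      case True
      then have t': "t \<in> {0..T0} - F" "0 < t" using t by auto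
      have dq: "d \<in> charts_at A (q t)" using d True by simp
      have "((snd d \<circ> q) has_vector_derivative (\<Sum>j | u t j \<noteq> 0. u t j *\<^sub>R V j (q t) d)) (at t)"
        using qd[OF t'(1) dq] at_within_Icc_at[OF t'(2) True] by simp
      then have "((snd d \<circ> ?q) has_vector_derivative (\<Sum>j | u t j \<noteq> 0. u t j *\<^sub>R V j (q t) d)) (at t)"
        by (rule has_vector_derivative_transform_within_open[where S = "{..<T0}"]) (use True in auto)
      then show ?thesis using True by simp
    next
      case False
      then have t': "0 < t - T0" "t - T0 < T" using t by auto
      define s where "s = t - T0"
      define p where "p = chart_inv c (\<gamma> s)"
      have s: "0 < s" "s < T" "s \<in> {0..T}" using t' by (auto simp: s_def)
      have p: "p \<in> fst c" "snd c p = \<gamma> s"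
        using inv_into_into[OF \<gamma>[OF s(3)]] f_inv_into_f[OF \<gamma>[OF s(3)]] by (auto simp: p_def)
      have qp: "?q t = p" using t' by (simp add: p_def s_def)
      have cp: "c \<in> charts_at A p" using c p by (simp add: charts_at_def)
      have dp: "d \<in> charts_at A p" using d qp by simp
      have g: "(\<gamma> has_vector_derivative \<sigma> *\<^sub>R coordinates c (V i) (\<gamma> s)) (at (t - T0))"
        using \<gamma>'[OF s(3)] at_within_Icc_at[OF s(1,2)] by (simp add: s_def)
      have "((\<lambda>t. t - T0) has_vector_derivative 1) (at t)"
        by (auto intro!: derivative_eq_intros)
      from vector_diff_chain_at[OF this g]
      have "((\<lambda>t. \<gamma> (t - T0)) has_vector_derivative \<sigma> *\<^sub>R V i p c) (at t)"
        by (simp add: o_def coordinates_def p_def)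
      moreover have D: "((snd d \<circ> chart_inv c) has_derivative transition_derivative c d p) (at (\<gamma> (t - T0)))"
        using has_derivative_transition[OF cp dp] p by (simp add: s_def)
      ultimately have "((snd d \<circ> chart_inv c \<circ> (\<lambda>t. \<gamma> (t - T0))) has_vector_derivative
          transition_derivative c d p (\<sigma> *\<^sub>R V i p c)) (at t)"
        using vector_derivative_diff_chain_within has_derivative_at_withinI by blast
      moreover have "transition_derivative c d p (\<sigma> *\<^sub>R V i p c) = \<sigma> *\<^sub>R V i p d"
      proof -
        have "p \<in> topspace X" using p chart_subset[OF c] by blast
        from tangent_change_of_chart[OF vector_field_tangent[OF V this] cp dp]
        show ?thesis using linear_scale[OF has_derivative_linear[OF D]] by simp
      qed
      ultimately have "((snd d \<circ> chart_inv c \<circ> (\<lambda>t. \<gamma> (t - T0))) has_vector_derivative \<sigma> *\<^sub>R V i p d) (at t)"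
        by simp
      then have 1: "((snd d \<circ> ?q) has_vector_derivative \<sigma> *\<^sub>R V i p d) (at t)"
        by (rule has_vector_derivative_transform_within_open[where S = "{T0<..}"]) (use t' in auto)
      have "{j. ?u t j \<noteq> 0} = {i}" using t' \<sigma> by (auto simp: constant_control_def)
      then have "(\<Sum>j | ?u t j \<noteq> 0. ?u t j *\<^sub>R V j (?q t) d) = \<sigma> *\<^sub>R V i p d"
        using t' qp by (simp add: constant_control_def)
      with 1 show ?thesis by simp
    qed
  qed
  show ?thesis
    unfolding trajectory_def
  proof (intro conjI exI[of _ "F \<union> {0, T0, T0+T}"] ballI)
    show "continuous_map (top_of_set {0..T0+T}) X ?q" by (rule cont)
    show "?q 0 = q0" using q0 T0 by simp
    show "finite (F \<union> {0, T0, T0+T})" using F by simp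
  qed (rule der)
qed

lemma reachable_setI:
  "0 \<le> T \<Longrightarrow> admissible_control u \<Longrightarrow> trajectory X A V u q0 T q \<Longrightarrow> q T \<in> reachable_set X A V q0"
  unfolding reachable_set_def by blast

lemma reachable_set_flow:
  assumes q: "q \<in> reachable_set X A V q0" and qc: "q \<in> fst c" and c: "c \<in> A" and T: "0 \<le> T"
    and V: "smooth_vector_field X A (V i)" and \<sigma>: "\<sigma> \<in> {-1, 1}"
    and \<gamma>0: "\<gamma> 0 = snd c q" and \<gamma>: "\<And>t. t \<in> {0..T} \<Longrightarrow> \<gamma> t \<in> snd c ` fst c"
    and \<gamma>': "\<And>t. t \<in> {0..T} \<Longrightarrow>
      (\<gamma> has_vector_derivative \<sigma> *\<^sub>R coordinates c (V i) (\<gamma> t)) (at t within {0..T})"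
  shows "chart_inv c (\<gamma> T) \<in> reachable_set X A V q0"
proof -
  obtain T0 u q1 where T0: "0 \<le> T0" and u: "admissible_control u"
    and traj: "trajectory X A V u q0 T0 q1" and qT: "q = q1 T0"
    using q unfolding reachable_set_def by blast
  have traj': "trajectory X A V (\<lambda>t. if t \<le> T0 then u t else constant_control i \<sigma>) q0 (T0 + T)
     (\<lambda>t. if t \<le> T0 then q1 t else chart_inv c (\<gamma> (t - T0)))"
    by (rule trajectory_append[OF traj T0 T V _ c _ _ \<gamma> \<gamma>']) (use \<sigma> qc \<gamma>0 qT in auto)
  have eq: "chart_inv c (\<gamma> T) = (\<lambda>t. if t \<le> T0 then q1 t else chart_inv c (\<gamma> (t - T0))) (T0 + T)"
    using T \<gamma>0 qT chart_inv_chart[OF c qc] by auto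
  show ?thesis
    unfolding eq
    by (rule reachable_setI[OF _ admissible_control_append[OF u \<sigma>] traj']) (use T0 T in simp)
qed

lemma reachable_set_subset: "reachable_set X A V q0 \<subseteq> topspace X"
proof
  fix q assume "q \<in> reachable_set X A V q0"
  then obtain T u q1 where T: "0 \<le> T" "q = q1 T" and "trajectory X A V u q0 T q1"
    unfolding reachable_set_def by blast
  then have "continuous_map (top_of_set {0..T}) X q1" by (simp add: trajectory_def)
  with T show "q \<in> topspace X" by (auto simp: continuous_map_def)
qed

lemma initial_point_reachable:
  assumes "q0 \<in> topspace X"
  shows "q0 \<in> reachable_set X A V q0"
proof -
  have "admissible_control (\<lambda>t i. 0)"
    unfolding admissible_control_def piecewise_constant_def by auto
  moreover have "trajectory X A V (\<lambda>t i. 0) q0 0 (\<lambda>t. q0)"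
    unfolding trajectory_def using assms by (intro conjI exI[of _ "{0}"]) auto
  ultimately show ?thesis using reachable_setI[of 0 _ _ q0 "\<lambda>t. q0"] by blast
qed

definition reached_coordinates where
  "reached_coordinates V q0 c = snd c ` (reachable_set X A V q0 \<inter> fst c)"

text \<open>
  The generators are tangent to the reachable set because it contains their integral curves, forward
  with control value \<open>1\<close> and backward with control value \<open>-1\<close>. Over a short time \<open>h\<close> an integral curve stays in
  a ball of radius \<open>\<rho>\<close> on which the field varies by at most \<open>\<epsilon>\<close>, and hence deviates from the straight line by at
  most \<open>\<epsilon> h\<close>.
\<close>

lemma generator_tangent:
  assumes V: "smooth_vector_field X A (V i)" and c: "c \<in> A" and p: "p \<in> snd c ` fst c"
  shows "\<exists>r>0. uniformly_tangent (reached_coordinates V q0 c) (coordinates c (V i)) (ball p r)"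
proof -
  define f where "f = coordinates c (V i)"
  have f: "smooth_on (snd c ` fst c) f" unfolding f_def by (rule coordinates_smooth[OF V c])
  obtain r0 K where r0: "0 < r0" "ball p r0 \<subseteq> snd c ` fst c"
    and C11: "C11_on (ball p r0) f (\<lambda>x. frechet_derivative f (at x)) K"
    by (rule smooth_on_imp_C11_on[OF f chart_homeomorphic(2)[OF c] p]) (rule that)
  have K: "0 \<le> K" using C11 by (simp add: C11_on_def)
  have "uniformly_tangent (reached_coordinates V q0 c) f (ball p (r0/2))"
  proof (rule uniformly_tangentI)
    fix \<epsilon> :: real assume \<epsilon>: "0 < \<epsilon>"
    define \<rho> where "\<rho> = min (r0/4) (\<epsilon> / (K + 1))"
    have \<rho>: "0 < \<rho>" "\<rho> \<le> r0/4" "(K + 1) * \<rho> \<le> \<epsilon>"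
    proof -
      show "0 < \<rho>" using r0(1) \<epsilon> K by (simp add: \<rho>_def)
      show "\<rho> \<le> r0/4" unfolding \<rho>_def by (rule min.cobounded1)
      have "\<rho> \<le> \<epsilon> / (K + 1)" by (simp add: \<rho>_def)
      then show "(K + 1) * \<rho> \<le> \<epsilon>" using K by (simp add: pos_le_divide_eq mult.commute)
    qed
    have K\<rho>: "K * \<rho> \<le> \<epsilon>" using \<rho> by (simp add: algebra_simps)
    define \<delta> where "\<delta> = min (\<rho> / (K + 1)) (1 / (2 * (K + 1)))"
    have \<delta>: "0 < \<delta>" using \<rho> K by (simp add: \<delta>_def)
    have "\<exists>y\<in>reached_coordinates V q0 c. norm (y - x - h *\<^sub>R f x) \<le> \<epsilon> * \<bar>h\<bar>"
      if x: "x \<in> reached_coordinates V q0 c" "x \<in> ball p (r0/2)" and h: "\<bar>h\<bar> \<le> \<delta>" for x h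
    proof -
      obtain q where q: "q \<in> reachable_set X A V q0" "q \<in> fst c" "x = snd c q"
        using x(1) by (auto simp: reached_coordinates_def)
      define \<sigma> :: real where "\<sigma> = (if 0 \<le> h then 1 else -1)"
      have \<sigma>: "\<sigma> \<in> {-1, 1}" "\<bar>h\<bar> * \<sigma> = h" "\<bar>\<sigma>\<bar> = 1" by (auto simp: \<sigma>_def)
      have sub: "cball x \<rho> \<subseteq> ball p r0"
      proof
        fix y assume "y \<in> cball x \<rho>"
        then have "dist x y \<le> \<rho>" by simp
        moreover have "dist p y \<le> dist p x + dist x y" by (rule dist_triangle)
        ultimately show "y \<in> ball p r0" using x(2) \<rho>(2) r0(1) unfolding mem_ball by linarith
      qed
      have "\<bar>h\<bar> \<le> \<rho> / (K + 1)" "\<bar>h\<bar> \<le> 1 / (2 * (K + 1))" using h by (auto simp: \<delta>_def)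
      then have "(K + 1) * \<bar>h\<bar> \<le> \<rho>" "2 * ((K + 1) * \<bar>h\<bar>) \<le> 1"
        using K by (simp_all add: pos_le_divide_eq mult.commute mult.left_commute)
      then have Kh: "K * \<bar>h\<bar> \<le> \<rho>" "K * \<bar>h\<bar> \<le> 1/2" by (simp_all add: algebra_simps)
      obtain \<gamma> where \<gamma>: "\<gamma> 0 = x" "\<And>t. t \<in> {0..\<bar>h\<bar>} \<Longrightarrow> \<gamma> t \<in> cball x \<rho>"
        "\<And>t. t \<in> {0..\<bar>h\<bar>} \<Longrightarrow> (\<gamma> has_vector_derivative \<sigma> *\<^sub>R f (\<gamma> t)) (at t within {0..\<bar>h\<bar>})"
      proof (rule picard_local_solution[of K x \<rho> "\<lambda>y. \<sigma> *\<^sub>R f y" "\<bar>h\<bar>"])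
        show "norm (\<sigma> *\<^sub>R f y) \<le> K" if "y \<in> cball x \<rho>" for y
          using C11_onD(3)[OF C11] sub that \<sigma>(3) by auto
        show "norm (\<sigma> *\<^sub>R f y - \<sigma> *\<^sub>R f z) \<le> K * norm (y - z)" if "y \<in> cball x \<rho>" "z \<in> cball x \<rho>" for y z
        proof -
          have "y \<in> ball p r0" "z \<in> ball p r0" using that sub by blast+
          from C11_onD2(1)[OF C11 this(2,1)] \<sigma>(3) show ?thesis by (simp flip: scaleR_diff_right)
        qed
      qed (use K \<rho> Kh that in auto)
      have in_chart: "\<gamma> t \<in> snd c ` fst c" if "t \<in> {0..\<bar>h\<bar>}" for t
        using \<gamma>(2)[OF that] sub r0(2) by blast
      have h0: "\<bar>h\<bar> \<in> {0..\<bar>h\<bar>}" "0 \<in> {0..\<bar>h\<bar>}" by auto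
      have reach: "chart_inv c (\<gamma> \<bar>h\<bar>) \<in> reachable_set X A V q0"
        by (rule reachable_set_flow[where \<gamma> = \<gamma> and \<sigma> = \<sigma> and i = i, OF q(1,2) c _ V \<sigma>(1)])
          (use \<gamma> in_chart q(3) in \<open>auto simp: f_def\<close>)
      have y: "\<gamma> \<bar>h\<bar> \<in> reached_coordinates V q0 c"
        unfolding reached_coordinates_def
        using reach inv_into_into[OF in_chart[OF h0(1)]] f_inv_into_f[OF in_chart[OF h0(1)]]
        by (intro image_eqI[of _ _ "chart_inv c (\<gamma> \<bar>h\<bar>)"]) auto
      have "norm ((\<gamma> \<bar>h\<bar> - \<bar>h\<bar> *\<^sub>R (\<sigma> *\<^sub>R f x)) - (\<gamma> 0 - 0 *\<^sub>R (\<sigma> *\<^sub>R f x))) \<le> \<epsilon> * norm (\<bar>h\<bar> - 0)"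
      proof (rule differentiable_bound[OF _ _ _ h0])
        show "convex {0..\<bar>h\<bar>}" by simp
        fix t assume t: "t \<in> {0..\<bar>h\<bar>}"
        show "((\<lambda>t. \<gamma> t - t *\<^sub>R (\<sigma> *\<^sub>R f x)) has_derivative (\<lambda>k. k *\<^sub>R (\<sigma> *\<^sub>R f (\<gamma> t)) - k *\<^sub>R (\<sigma> *\<^sub>R f x)))
            (at t within {0..\<bar>h\<bar>})"
          using \<gamma>(3)[OF t] unfolding has_vector_derivative_def
          by (intro has_derivative_diff) (auto intro!: derivative_eq_intros)
        have bnd: "norm (\<sigma> *\<^sub>R (f (\<gamma> t) - f x)) \<le> \<epsilon>"
        proof -
          have xb: "x \<in> ball p r0" using x(2) r0(1) by auto
          have "norm (f (\<gamma> t) - f x) \<le> K * norm (\<gamma> t - x)"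
            by (rule C11_onD2(1)[OF C11 xb]) (use \<gamma>(2)[OF t] sub in blast)
          also have "\<dots> \<le> K * \<rho>"
            using \<gamma>(2)[OF t] K by (intro mult_left_mono) (auto simp: dist_norm norm_minus_commute)
          finally show ?thesis using K\<rho> \<sigma>(3) by simp
        qed
        show "onorm (\<lambda>k. k *\<^sub>R (\<sigma> *\<^sub>R f (\<gamma> t)) - k *\<^sub>R (\<sigma> *\<^sub>R f x)) \<le> \<epsilon>"
        proof (rule onorm_bound)
          fix k :: real
          have "k *\<^sub>R (\<sigma> *\<^sub>R f (\<gamma> t)) - k *\<^sub>R (\<sigma> *\<^sub>R f x) = k *\<^sub>R (\<sigma> *\<^sub>R (f (\<gamma> t) - f x))"
            by (simp only: scaleR_diff_right)
          then show "norm (k *\<^sub>R (\<sigma> *\<^sub>R f (\<gamma> t)) - k *\<^sub>R (\<sigma> *\<^sub>R f x)) \<le> \<epsilon> * norm k"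
            using mult_left_mono[OF bnd, of "\<bar>k\<bar>"] by (simp only: norm_scaleR[of k] real_norm_def mult.commute abs_ge_zero)
        qed (use \<epsilon> in simp)
      qed
      then have "norm (\<gamma> \<bar>h\<bar> - x - h *\<^sub>R f x) \<le> \<epsilon> * \<bar>h\<bar>"
        using \<gamma>(1) \<sigma>(2) by (simp add: algebra_simps)
      with y show ?thesis by blast
    qed
    then show "\<exists>\<delta>>0. \<forall>x h. x \<in> reached_coordinates V q0 c \<longrightarrow> x \<in> ball p (r0/2) \<longrightarrow> \<bar>h\<bar> \<le> \<delta> \<longrightarrow>
        (\<exists>y\<in>reached_coordinates V q0 c. norm (y - x - h *\<^sub>R f x) \<le> \<epsilon> * \<bar>h\<bar>)"
      using \<delta> by (intro exI[of _ \<delta>]) simp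
  qed
  then show ?thesis using r0 unfolding f_def by (intro exI[of _ "r0/2"]) simp
qed

end

section \<open>The closure of the reachable set is open\<close>

lemma uniformly_tangent_cong:
  assumes "\<And>x. x \<in> B \<Longrightarrow> f x = g x"
  shows "uniformly_tangent S f B \<longleftrightarrow> uniformly_tangent S g B"
  using assms unfolding uniformly_tangent_def by simp

context banach_atlas
begin

text \<open>
  Induction over the bracket expression, in all charts simultaneously; smoothness is carried along
  because it supplies the second-order bounds for the commutator.
\<close>

lemma iterated_bracket_tangent:
  assumes sep: "\<forall>v::'e. v \<noteq> 0 \<longrightarrow> (\<exists>l :: 'e \<Rightarrow> real. bounded_linear l \<and> l v \<noteq> 0)"
    and V: "\<And>i. smooth_vector_field X A (V i)"
    and B: "B \<in> iterated_brackets X A V"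
  shows "smooth_vector_field X A B \<and> (\<forall>c\<in>A. \<forall>p\<in>snd c ` fst c.
    \<exists>r>0. uniformly_tangent (reached_coordinates V q0 c) (coordinates c B) (ball p r))"
  using B
proof (induction rule: iterated_brackets.induct)
  case (generator i)
  show ?case
  proof (intro conjI ballI)
    show "smooth_vector_field X A (V i)" by (rule V)
  qed (rule generator_tangent[where V = V, OF V])
next
  case (bracket B C Z)
  note B = bracket.IH(1)[THEN conjunct1] and C = bracket.IH(2)[THEN conjunct1]
    and Z = bracket.hyps(3)
  show ?case
  proof (intro conjI ballI)
    show "smooth_vector_field X A Z" using Z by (simp add: is_lie_bracket_def)
    fix c p assume c: "c \<in> A" and p: "p \<in> snd c ` fst c"
    define R where "R = reached_coordinates V q0 c"
    note O = chart_homeomorphic(2)[OF c]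
    obtain r1 where r1: "0 < r1" "uniformly_tangent R (coordinates c B) (ball p r1)"
      using bracket.IH(1)[THEN conjunct2, rule_format, OF c p] unfolding R_def by (elim exE conjE)
    obtain r2 where r2: "0 < r2" "uniformly_tangent R (coordinates c C) (ball p r2)"
      using bracket.IH(2)[THEN conjunct2, rule_format, OF c p] unfolding R_def by (elim exE conjE)
    obtain r3 K3 where r3: "0 < r3" "ball p r3 \<subseteq> snd c ` fst c"
      "C11_on (ball p r3) (coordinates c B) (\<lambda>x. frechet_derivative (coordinates c B) (at x)) K3"
      by (rule smooth_on_imp_C11_on[OF coordinates_smooth[OF B c] O p]) (rule that)
    obtain r4 K4 where r4: "0 < r4" "ball p r4 \<subseteq> snd c ` fst c"
      "C11_on (ball p r4) (coordinates c C) (\<lambda>x. frechet_derivative (coordinates c C) (at x)) K4"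
      by (rule smooth_on_imp_C11_on[OF coordinates_smooth[OF C c] O p]) (rule that)
    define r where "r = min (min r1 r2) (min r3 r4)"
    have r: "0 < r" using r1 r2 r3 r4 by (simp add: r_def)
    have sub: "ball p r \<subseteq> ball p r1" "ball p r \<subseteq> ball p r2" "ball p r \<subseteq> ball p r3" "ball p r \<subseteq> ball p r4"
      by (simp_all add: r_def subset_ball)
    have "uniformly_tangent R
        (\<lambda>x. frechet_derivative (coordinates c C) (at x) (coordinates c B x)
          - frechet_derivative (coordinates c B) (at x) (coordinates c C x)) (ball p (r/4))"
      by (rule uniformly_tangent_bracket[OF C11_on_mono[OF r3(3) max.cobounded1 sub(3)]
            C11_on_mono[OF r4(3) max.cobounded2 sub(4)]
            uniformly_tangent_subset[OF r1(2) sub(1)] uniformly_tangent_subset[OF r2(2) sub(2)] r])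
    moreover have "coordinates c Z x = frechet_derivative (coordinates c C) (at x) (coordinates c B x)
          - frechet_derivative (coordinates c B) (at x) (coordinates c C x)" if "x \<in> ball p (r/4)" for x
    proof (rule bracket_in_coordinates[OF sep B C Z c])
      have "x \<in> ball p r" using that r by auto
      then show "x \<in> snd c ` fst c" using sub(3) r3(2) by blast
    qed
    ultimately have "uniformly_tangent R (coordinates c Z) (ball p (r/4))"
      using uniformly_tangent_cong[of "ball p (r/4)" "coordinates c Z"] by simp
    then show "\<exists>r>0. uniformly_tangent (reached_coordinates V q0 c) (coordinates c Z) (ball p r)"
      using r unfolding R_def by (intro exI[of _ "r/4"]) simp
  qed
qed

lemma iterated_bracket_lipschitz_tangent:
  assumes sep: "\<forall>v::'e. v \<noteq> 0 \<longrightarrow> (\<exists>l :: 'e \<Rightarrow> real. bounded_linear l \<and> l v \<noteq> 0)"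
    and V: "\<And>i. smooth_vector_field X A (V i)"
    and B: "B \<in> iterated_brackets X A V" and c: "c \<in> A" and p: "p \<in> snd c ` fst c"
  shows "lipschitz_tangent (reached_coordinates V q0 c) (coordinates c B) p"
proof -
  note BV = iterated_bracket_tangent[OF sep V B, where ?q0.0 = q0]
  obtain r1 where r1: "0 < r1" "uniformly_tangent (reached_coordinates V q0 c) (coordinates c B) (ball p r1)"
    using BV[THEN conjunct2, rule_format, OF c p] by (elim exE conjE)
  obtain r2 K where r2: "0 < r2" "ball p r2 \<subseteq> snd c ` fst c"
      "C11_on (ball p r2) (coordinates c B) (\<lambda>x. frechet_derivative (coordinates c B) (at x)) K"
    by (rule smooth_on_imp_C11_on[OF coordinates_smooth[OF BV[THEN conjunct1] c] chart_homeomorphic(2)[OF c] p])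
      (rule that)
  define r where "r = min r1 r2"
  have sub: "ball p r \<subseteq> ball p r1" "ball p r \<subseteq> ball p r2" by (simp_all add: r_def subset_ball)
  show ?thesis
    unfolding lipschitz_tangent_def
  proof (rule exI[of _ r], intro conjI exI[of _ K] ballI)
    show "0 < r" using r1 r2 by (simp add: r_def)
    show "0 \<le> K" using r2(3) by (simp add: C11_on_def)
    show "uniformly_tangent (reached_coordinates V q0 c) (coordinates c B) (ball p r)"
      by (rule uniformly_tangent_subset[OF r1(2) sub(1)])
    fix x assume x: "x \<in> ball p r"
    then have x': "x \<in> ball p r2" using sub by blast
    show "norm (coordinates c B x) \<le> K" by (rule C11_onD(3)[OF r2(3) x'])
    fix y assume "y \<in> ball p r"
    then have y': "y \<in> ball p r2" using sub by blast
    show "norm (coordinates c B y - coordinates c B x) \<le> K * norm (y - x)"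
      by (rule C11_onD2(1)[OF r2(3) x' y'])
  qed
qed

lemma lie_span_approximates:
  assumes dense: "tangent_topology A q closure_of (lie_span X A V q) = tangent_space A q"
    and c: "c \<in> charts_at A q" and \<epsilon>: "0 < \<epsilon>"
  obtains w where "w \<in> lie_span X A V q" "norm (w c - e) < \<epsilon>"
proof -
  obtain v where v: "v \<in> tangent_space A q" "v c = e" using tangent_with_coordinate[OF c] by blast
  define W where "W = {v \<in> tangent_space A q. v c \<in> ball e \<epsilon>}"
  have "openin (tangent_topology A q) W"
    unfolding tangent_topology_def
  proof (rule topology_generated_by_Basis)
    show "W \<in> {{v \<in> tangent_space A q. v c \<in> W} | c W. c \<in> charts_at A q \<and> open W}"
      unfolding W_def using c open_ball by blast
  qed
  moreover have "v \<in> W" using v \<epsilon> by (simp add: W_def)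
  moreover have "v \<in> tangent_topology A q closure_of (lie_span X A V q)" using dense v by simp
  ultimately obtain w where "w \<in> lie_span X A V q" "w \<in> W" unfolding in_closure_of by blast
  then show ?thesis using that[of w] by (simp add: W_def dist_norm norm_minus_commute)
qed

lemma lie_span_representation:
  assumes "w \<in> lie_span X A V q"
  obtains F :: "('m, 'e) tangent set" and a B where "finite F" "\<forall>b\<in>F. B b \<in> iterated_brackets X A V"
    "\<forall>c. w c = (\<Sum>b\<in>F. a b *\<^sub>R B b q c)"
proof -
  obtain F a where F: "finite F" "F \<subseteq> (\<lambda>B. B q) ` iterated_brackets X A V"
    and w: "w = (\<lambda>c. \<Sum>b\<in>F. a b *\<^sub>R b c)"
    using assms unfolding lie_span_def tangent_span_def by blast
  define B where "B b = (SOME B. B \<in> iterated_brackets X A V \<and> B q = b)" for b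
  have B: "B b \<in> iterated_brackets X A V \<and> B b q = b" if "b \<in> F" for b
  proof -
    have "\<exists>B. B \<in> iterated_brackets X A V \<and> B q = b" using F(2) that by blast
    then show ?thesis unfolding B_def by (rule someI_ex)
  qed
  show ?thesis
    by (rule that[of F B a]) (use F(1) B w in \<open>auto intro!: sum.cong\<close>)
qed

text \<open>
  Every direction \<open>e\<close> is approximated by the value at \<open>s\<close> of a fixed linear combination \<open>G\<close> of iterated
  brackets. Tangency holds at points of the reachable set, so the step along \<open>G\<close> starts at such a point \<open>x\<close>, taken
  so close to \<open>s\<close> that replacing \<open>s\<close> by \<open>x\<close> costs only a small multiple of \<open>h\<close>.
\<close>

lemma contingent_cone_full:
  assumes sep: "\<forall>v::'e. v \<noteq> 0 \<longrightarrow> (\<exists>l :: 'e \<Rightarrow> real. bounded_linear l \<and> l v \<noteq> 0)"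
    and V: "\<And>i. smooth_vector_field X A (V i)"
    and dense: "\<forall>q\<in>topspace X. tangent_topology A q closure_of (lie_span X A V q) = tangent_space A q"
    and c: "c \<in> A" and s: "s \<in> snd c ` fst c" "s \<in> closure (reached_coordinates V q0 c)"
    and \<epsilon>: "0 < \<epsilon>" and \<delta>: "0 < \<delta>"
  shows "\<exists>h y. 0 < h \<and> h \<le> \<delta> \<and> y \<in> reached_coordinates V q0 c \<and> norm (y - s - h *\<^sub>R e) \<le> \<epsilon> * h"
proof -
  define R where "R = reached_coordinates V q0 c"
  define q where "q = chart_inv c s"
  have q: "q \<in> fst c" "q \<in> topspace X" "c \<in> charts_at A q"
    using inv_into_into[OF s(1)] chart_subset[OF c] c by (auto simp: q_def charts_at_def)
  have e4: "0 < \<epsilon> / 4" using \<epsilon> by simp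
  obtain w where w: "w \<in> lie_span X A V q" "norm (w c - e) < \<epsilon> / 4"
    by (rule lie_span_approximates[OF bspec[OF dense q(2)] q(3) e4]) (rule that)
  obtain F :: "('m, 'e) tangent set" and a B where F: "finite F" "\<forall>b\<in>F. B b \<in> iterated_brackets X A V"
    and wF: "\<forall>c. w c = (\<Sum>b\<in>F. a b *\<^sub>R B b q c)"
    by (rule lie_span_representation[OF w(1)]) (rule that)
  define G where "G x = (\<Sum>b\<in>F. a b *\<^sub>R coordinates c (B b) x)" for x
  have Gs: "G s = w c" unfolding G_def coordinates_def q_def[symmetric] by (rule wF[rule_format, symmetric])
  have "lipschitz_tangent R (\<lambda>x. \<Sum>b\<in>F. a b *\<^sub>R coordinates c (B b) x) s"
    unfolding R_def
    by (rule lipschitz_tangent_sum[OF F(1)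
          iterated_bracket_lipschitz_tangent[OF sep V bspec[OF F(2)] c s(1)]])
  then have "lipschitz_tangent R G s" by (simp add: G_def[abs_def])
  then obtain r K where r: "0 < r" and K: "0 \<le> K"
    and lip: "\<And>x y. x \<in> ball s r \<Longrightarrow> y \<in> ball s r \<Longrightarrow> norm (G y - G x) \<le> K * norm (y - x)"
    and tan: "uniformly_tangent R G (ball s r)"
    by (rule lipschitz_tangentD) (rule that)
  obtain \<delta>' where \<delta>': "0 < \<delta>'"
    and step: "\<And>x h. x \<in> R \<Longrightarrow> x \<in> ball s r \<Longrightarrow> \<bar>h\<bar> \<le> \<delta>' \<Longrightarrow> \<exists>y\<in>R. norm (y - x - h *\<^sub>R G x) \<le> \<epsilon> / 4 * \<bar>h\<bar>"
    by (rule uniformly_tangentD[OF tan e4]) (rule that)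
  define h where "h = min \<delta> \<delta>'"
  have h: "0 < h" "h \<le> \<delta>" "\<bar>h\<bar> \<le> \<delta>'" using \<delta> \<delta>' by (auto simp: h_def)
  have hK: "0 < 1 + h * K" using h K by (simp add: add_pos_nonneg)
  \<comment> \<open>The summand \<open>h * K\<close> accounts for evaluating \<open>G\<close> at \<open>x\<close> instead of \<open>s\<close>.\<close>
  define \<eta> where "\<eta> = min r ((\<epsilon> / 4 * h) / (1 + h * K))"
  have \<eta>: "0 < \<eta>" using r e4 h hK by (simp add: \<eta>_def)
  obtain x where x: "x \<in> R" "dist x s < \<eta>"
    using s(2) \<eta> unfolding closure_approachable R_def by blast
  have xr: "x \<in> ball s r" using x(2) by (simp add: \<eta>_def dist_commute)
  have sr: "s \<in> ball s r" using r by simp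
  have "norm (x - s) \<le> (\<epsilon> / 4 * h) / (1 + h * K)" using x(2) by (simp add: \<eta>_def dist_norm)
  then have xs: "norm (x - s) * (1 + h * K) \<le> \<epsilon> / 4 * h" using hK by (simp only: pos_le_divide_eq)
  obtain y where y: "y \<in> R" "norm (y - x - h *\<^sub>R G x) \<le> \<epsilon> / 4 * \<bar>h\<bar>" using step[OF x(1) xr h(3)] by blast
  have "norm (h *\<^sub>R (G x - G s)) \<le> h * (K * norm (x - s))"
    using lip[OF sr xr] h(1) by simp
  moreover have "norm (h *\<^sub>R (G s - e)) \<le> h * (\<epsilon> / 4)"
    using w(2) h(1) by (simp add: Gs)
  moreover have "norm (y - s - h *\<^sub>R e)
      = norm ((x - s) + (y - x - h *\<^sub>R G x) + h *\<^sub>R (G x - G s) + h *\<^sub>R (G s - e))"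
    by (simp add: algebra_simps)
  ultimately have "norm (y - s - h *\<^sub>R e) \<le> norm (x - s) + \<epsilon> / 4 * h + h * (K * norm (x - s)) + h * (\<epsilon> / 4)"
    using y(2) h(1) by (simp only: norm_add_le4 abs_of_pos order_refl)
  also have "\<dots> = norm (x - s) * (1 + h * K) + \<epsilon> / 4 * h + h * (\<epsilon> / 4)" by (simp add: algebra_simps)
  also have "\<dots> \<le> \<epsilon> * h"
  proof -
    have "0 \<le> \<epsilon> * h" using \<epsilon> h(1) by simp
    then show ?thesis using xs by (simp add: mult.commute)
  qed
  finally show ?thesis using y(1) h unfolding R_def by blast
qed

lemma chart_closure_of:
  assumes c: "c \<in> A" and q: "q \<in> fst c" and R: "q \<in> X closure_of R"
  shows "snd c q \<in> closure (snd c ` (R \<inter> fst c))"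
  unfolding closure_iff_nhds_not_empty
proof (intro allI impI)
  fix N W assume W: "W \<subseteq> N" "open W" "snd c q \<in> W"
  have "openin X {p \<in> fst c. snd c p \<in> W}" by (rule openin_chart_preimage[OF c W(2)])
  then have "q \<in> {p \<in> fst c. snd c p \<in> W} \<and> openin X {p \<in> fst c. snd c p \<in> W}" using q W(3) by simp
  from R[unfolded in_closure_of, THEN conjunct2, THEN spec, THEN mp, OF this]
  obtain p where "p \<in> R" "p \<in> fst c" "snd c p \<in> W" by (elim exE conjE CollectE) (rule that)
  then have "snd c p \<in> snd c ` (R \<inter> fst c) \<inter> N" using W(1) by blast
  then show "snd c ` (R \<inter> fst c) \<inter> N \<noteq> {}" by blast
qed

lemma chart_inv_closure_of:
  assumes c: "c \<in> A" and x: "x \<in> snd c ` fst c" "x \<in> closure (snd c ` (R \<inter> fst c))"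
  shows "chart_inv c x \<in> X closure_of R"
  unfolding in_closure_of
proof (intro conjI allI impI)
  show "chart_inv c x \<in> topspace X" using inv_into_into[OF x(1)] chart_subset[OF c] by blast
  fix N assume N: "chart_inv c x \<in> N \<and> openin X N"
  then have "open (snd c ` (fst c \<inter> N))" using open_chart_image[OF c] by blast
  moreover have "x \<in> snd c ` (fst c \<inter> N)"
    using N inv_into_into[OF x(1)] f_inv_into_f[OF x(1)] by (intro image_eqI[of _ _ "chart_inv c x"]) auto
  ultimately have "snd c ` (R \<inter> fst c) \<inter> snd c ` (fst c \<inter> N) \<noteq> {}"
    using x(2) unfolding closure_iff_nhds_not_empty by blast
  then obtain p p' where "p \<in> R" "p \<in> fst c" "p' \<in> fst c" "p' \<in> N" "snd c p = snd c p'" by blast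
  moreover from this have "p = p'" using inj_onD[OF chart_inj[OF c]] by blast
  ultimately show "\<exists>p. p \<in> R \<and> p \<in> N" by blast
qed

lemma closure_reachable_set_open:
  assumes sep: "\<forall>v::'e. v \<noteq> 0 \<longrightarrow> (\<exists>l :: 'e \<Rightarrow> real. bounded_linear l \<and> l v \<noteq> 0)"
    and V: "\<And>i. smooth_vector_field X A (V i)"
    and dense: "\<forall>q\<in>topspace X. tangent_topology A q closure_of (lie_span X A V q) = tangent_space A q"
  shows "openin X (X closure_of (reachable_set X A V q0))"
proof (subst openin_subopen, intro ballI)
  define R where "R = reachable_set X A V q0"
  fix q assume q: "q \<in> X closure_of (reachable_set X A V q0)"
  then have "q \<in> topspace X" by (simp add: in_closure_of)
  then obtain c where cq: "c \<in> charts_at A q" using chart_exists by blast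
  then have c: "c \<in> A" "q \<in> fst c" using charts_atD by auto
  have p: "snd c q \<in> closure (reached_coordinates V q0 c)"
    unfolding reached_coordinates_def by (rule chart_closure_of[OF c q])
  obtain r where r: "0 < r" "ball (snd c q) r \<subseteq> snd c ` fst c"
    using chart_homeomorphic(2)[OF c(1)] c(2) open_contains_ball by blast
  have ball: "ball (snd c q) (r/4) \<subseteq> closure (reached_coordinates V q0 c)"
    by (rule contingent_cone_full_imp_ball_subset_closure[OF p r(1)
          contingent_cone_full[OF sep V dense c(1)]]) (use r(2) in blast)+
  define N where "N = {p \<in> fst c. snd c p \<in> ball (snd c q) (r/4)}"
  have "openin X N" unfolding N_def by (rule openin_chart_preimage[OF c(1) open_ball])
  moreover have "q \<in> N" using c r(1) by (simp add: N_def)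
  moreover have "N \<subseteq> X closure_of (reachable_set X A V q0)"
  proof
    fix p assume "p \<in> N"
    then have p: "p \<in> fst c" "snd c p \<in> closure (snd c ` (reachable_set X A V q0 \<inter> fst c))"
      using ball unfolding N_def reached_coordinates_def by auto
    from chart_inv_closure_of[OF c(1) imageI[OF p(1)] p(2)]
    show "p \<in> X closure_of (reachable_set X A V q0)" using chart_inv_chart[OF c(1) p(1)] by simp
  qed
  ultimately show "\<exists>T. openin X T \<and> q \<in> T \<and> T \<subseteq> X closure_of (reachable_set X A V q0)" by blast
qed

end

theorem theorem6p2:
  fixes X :: "'m topology"
    and A :: "('m, 'e::banach) chart set"
    and V :: "nat \<Rightarrow> 'm \<Rightarrow> ('m, 'e) tangent"
  assumes "banach_manifold X A"
    and "connected_space X"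
    and "infinite_dimensional TYPE('e)"
    and "smooth_banach_space TYPE('e)"
    and "\<And>i. smooth_vector_field X A (V i)"
    and "\<And>q. q \<in> topspace X \<Longrightarrow>
           tangent_topology A q closure_of (lie_span X A V q) = tangent_space A q"
  shows "globally_approx_controllable X A V"
  unfolding globally_approx_controllable_def
proof
  interpret banach_atlas X A by unfold_locales (rule assms(1))
  have sep: "\<forall>v::'e. v \<noteq> 0 \<longrightarrow> (\<exists>l :: 'e \<Rightarrow> real. bounded_linear l \<and> l v \<noteq> 0)"
    using assms(4) bump_separates_points unfolding smooth_banach_space_def by blast
  have dense: "\<forall>q\<in>topspace X. tangent_topology A q closure_of (lie_span X A V q) = tangent_space A q"
    using assms(6) by blast
  fix q0 assume q0: "q0 \<in> topspace X"
  let ?S = "X closure_of (reachable_set X A V q0)"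
  have "openin X ?S" by (rule closure_reachable_set_open[OF sep assms(5) dense])
  moreover have "closedin X ?S" by (rule closedin_closure_of)
  moreover have "q0 \<in> ?S"
    using closure_of_subset[OF reachable_set_subset] initial_point_reachable[OF q0] by blast
  ultimately show "?S = topspace X" using assms(2) unfolding connected_space_clopen_in by blast
qed

end
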